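(* Let $R$ be an associative ring with unit and let $M$ be a left unital $R$-module having property $AB5^{\ast}$ such that every small submodule of $M$ has finite hollow dimension. Then every submodule of $\mathrm{Rad}(M)$ has finite hollow dimension.
   Context: Rings are associative with unit and modules are left unital. A submodule $N$ of a module $M$ is small in $M$, written $N \ll M$, if $N+K=M$ for a submodule $K\subseteq M$ implies $K=M$. $\mathrm{Rad}(M)$ denotes the sum of all small submodules of $M$. An $R$-module $M$ has property $AB5^{\ast}$ if for every submodule $N$ of $M$ and every inverse system $\{M_i\}_{i\in I}$ of submodules of $M$ (i.e. a nonempty family such that for all $i,j\in I$ there is $k\in I$ with $M_k\subseteq M_i\cap M_j$) one has $N+\bigcap_{i\in I}M_i=\bigcap_{i\in I}(N+M_i)$. A module $H$ is hollow if $H\neq 0$ and every proper submodule of $H$ is small in $H$. A module $X$ has finite hollow dimension (finite dual Goldie dimension) if there is an epimorphism with small kernel from $X$ onto a finite direct sum of non-zero hollow factor modules of $X$ (the empty direct sum being allowed, so that the zero module has finite hollow dimension). *)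

theory Defs
  imports "HOL-Algebra.Module" "HOL-Algebra.AbelCoset"
begin

text \<open>
  The library locale \<open>module\<close> requires a commutative ring of scalars. The record type
  and the predicate \<open>submodule\<close> do not, and are reused here. A submodule \<open>N\<close> of \<open>M\<close> is
  regarded as a module in its own right in the form \<open>M\<lparr>carrier := N\<rparr>\<close>.
\<close>

locale left_module = R?: ring R + M?: abelian_group M
  for R :: "('r, 'p) ring_scheme" (structure) and M :: "('r, 'm, 'q) module_scheme" (structure) +
  assumes smult_closed [simp, intro]:
      "\<lbrakk>a \<in> carrier R; x \<in> carrier M\<rbrakk> \<Longrightarrow> a \<odot>\<^bsub>M\<^esub> x \<in> carrier M"
    and smult_l_distr:
      "\<lbrakk>a \<in> carrier R; b \<in> carrier R; x \<in> carrier M\<rbrakk> \<Longrightarrow>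
        (a \<oplus>\<^bsub>R\<^esub> b) \<odot>\<^bsub>M\<^esub> x = a \<odot>\<^bsub>M\<^esub> x \<oplus>\<^bsub>M\<^esub> b \<odot>\<^bsub>M\<^esub> x"
    and smult_r_distr:
      "\<lbrakk>a \<in> carrier R; x \<in> carrier M; y \<in> carrier M\<rbrakk> \<Longrightarrow>
        a \<odot>\<^bsub>M\<^esub> (x \<oplus>\<^bsub>M\<^esub> y) = a \<odot>\<^bsub>M\<^esub> x \<oplus>\<^bsub>M\<^esub> a \<odot>\<^bsub>M\<^esub> y"
    and smult_assoc1:
      "\<lbrakk>a \<in> carrier R; b \<in> carrier R; x \<in> carrier M\<rbrakk> \<Longrightarrow>
        (a \<otimes>\<^bsub>R\<^esub> b) \<odot>\<^bsub>M\<^esub> x = a \<odot>\<^bsub>M\<^esub> (b \<odot>\<^bsub>M\<^esub> x)"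
    and smult_one [simp]:
      "x \<in> carrier M \<Longrightarrow> \<one>\<^bsub>R\<^esub> \<odot>\<^bsub>M\<^esub> x = x"

definition lmod_hom ::
  "('r, 'p) ring_scheme \<Rightarrow> ('r, 'm, 'q) module_scheme \<Rightarrow> ('r, 'n, 's) module_scheme \<Rightarrow> ('m \<Rightarrow> 'n) set"
  where "lmod_hom R M N = {f. f \<in> carrier M \<rightarrow> carrier N
    \<and> (\<forall>x\<in>carrier M. \<forall>y\<in>carrier M. f (x \<oplus>\<^bsub>M\<^esub> y) = f x \<oplus>\<^bsub>N\<^esub> f y)
    \<and> (\<forall>r\<in>carrier R. \<forall>x\<in>carrier M. f (r \<odot>\<^bsub>M\<^esub> x) = r \<odot>\<^bsub>N\<^esub> f x)}"

text \<open>
  The module record extends the ring record; its multiplicative fields play no role for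
  modules and are left undefined below.
\<close>

definition quot_module :: "('r, 'm, 'q) module_scheme \<Rightarrow> 'm set \<Rightarrow> ('r, 'm set) module"
  where "quot_module M K =
    \<lparr>carrier = a_rcosets\<^bsub>M\<^esub> K, mult = undefined, one = undefined,
     zero = K, add = set_add M,
     smult = (\<lambda>r A. \<Union>x\<in>A. K +>\<^bsub>M\<^esub> (r \<odot>\<^bsub>M\<^esub> x))\<rparr>"

text \<open>The external direct sum of the finitely many modules \<open>X 0, \<dots>, X (n - 1)\<close>.\<close>

definition direct_sum :: "nat \<Rightarrow> (nat \<Rightarrow> ('r, 'm, 'q) module_scheme) \<Rightarrow> ('r, nat \<Rightarrow> 'm) module"
  where "direct_sum n X =
    \<lparr>carrier = (\<Pi>\<^sub>E i\<in>{..<n}. carrier (X i)), mult = undefined, one = undefined,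
     zero = (\<lambda>i\<in>{..<n}. \<zero>\<^bsub>X i\<^esub>),
     add = (\<lambda>x y. \<lambda>i\<in>{..<n}. x i \<oplus>\<^bsub>X i\<^esub> y i),
     smult = (\<lambda>r x. \<lambda>i\<in>{..<n}. r \<odot>\<^bsub>X i\<^esub> x i)\<rparr>"

definition small_submodule ::
  "('r, 'p) ring_scheme \<Rightarrow> ('r, 'm, 'q) module_scheme \<Rightarrow> 'm set \<Rightarrow> bool"
  where "small_submodule R M N \<longleftrightarrow> submodule N R M \<and>
    (\<forall>K. submodule K R M \<longrightarrow> N <+>\<^bsub>M\<^esub> K = carrier M \<longrightarrow> K = carrier M)"

text \<open>
  The sum of a possibly infinite family of submodules consists of the finite sums of
  elements taken from its members.
\<close>

definition Rad :: "('r, 'p) ring_scheme \<Rightarrow> ('r, 'm, 'q) module_scheme \<Rightarrow> 'm set"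
  where "Rad R M = {finsum M x S | x S. finite S \<and> S \<subseteq> {N. small_submodule R M N} \<and> (\<forall>N\<in>S. x N \<in> N)}"

text \<open>
  An inverse system enters the condition only through the set of its members, so
  it is given as a nonempty, downward directed set of submodules rather than as an indexed family.
\<close>

definition inverse_system ::
  "('r, 'p) ring_scheme \<Rightarrow> ('r, 'm, 'q) module_scheme \<Rightarrow> 'm set set \<Rightarrow> bool"
  where "inverse_system R M F \<longleftrightarrow> F \<noteq> {} \<and> (\<forall>A\<in>F. submodule A R M)
    \<and> (\<forall>A\<in>F. \<forall>B\<in>F. \<exists>C\<in>F. C \<subseteq> A \<inter> B)"

definition AB5_star :: "('r, 'p) ring_scheme \<Rightarrow> ('r, 'm, 'q) module_scheme \<Rightarrow> bool"
  where "AB5_star R M \<longleftrightarrow> (\<forall>N F. submodule N R M \<longrightarrow> inverse_system R M F \<longrightarrow>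
    N <+>\<^bsub>M\<^esub> (\<Inter>A\<in>F. A) = (\<Inter>A\<in>F. N <+>\<^bsub>M\<^esub> A))"

definition hollow :: "('r, 'p) ring_scheme \<Rightarrow> ('r, 'm, 'q) module_scheme \<Rightarrow> bool"
  where "hollow R H \<longleftrightarrow> carrier H \<noteq> {\<zero>\<^bsub>H\<^esub>}
    \<and> (\<forall>N. submodule N R H \<longrightarrow> N \<noteq> carrier H \<longrightarrow> small_submodule R H N)"

definition finite_hollow_dim :: "('r, 'p) ring_scheme \<Rightarrow> ('r, 'm, 'q) module_scheme \<Rightarrow> bool"
  where "finite_hollow_dim R X \<longleftrightarrow> (\<exists>n K f.
    (\<forall>i<n. submodule (K i) R X \<and> hollow R (quot_module X (K i)))
    \<and> f \<in> lmod_hom R X (direct_sum n (\<lambda>i. quot_module X (K i)))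
    \<and> f ` carrier X = carrier (direct_sum n (\<lambda>i. quot_module X (K i)))
    \<and> small_submodule R X (a_kernel X (direct_sum n (\<lambda>i. quot_module X (K i))) f))"

end

theory Submission
  imports Defs
begin

text \<open>
  A module has finite hollow dimension exactly when it has no infinite
  sequence of proper submodules in which every member adds up to the whole module with the
  intersection of any finitely many others (\<open>finite_hollow_dim_iff\<close>); call such a sequence
  coindependent. Suppose some \<open>N \<subseteq> Rad M\<close> has a coindependent sequence \<open>K\<^sub>0, K\<^sub>1, \<dots>\<close>. From it one
  builds a single small submodule \<open>U\<close> of \<open>M\<close> that has a coindependent sequence too; this contradicts
  the hypothesis on small submodules.

  The module \<open>U\<close> is generated by elements \<open>y\<^sub>0, y\<^sub>1, \<dots>\<close> such that \<open>y\<^sub>i\<close> lies in every \<open>K\<^sub>j\<close>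
  with \<open>j \<noteq> i\<close> but not in \<open>K\<^sub>i\<close>. Then the traces \<open>U \<inter> K\<^sub>i\<close> are proper in \<open>U\<close>, and they are
  coindependent, because each generator other than \<open>y\<^sub>i\<close> lies in the \<open>i\<close>-th trace while \<open>y\<^sub>i\<close> lies in all
  other traces. Property \<open>AB5\<^sup>*\<close> is used three times.

  \<^item> It passes from finite to infinite intersections: \<open>K\<^sub>i\<close> plus the intersection of all other \<open>K\<^sub>j\<close>
    is \<open>N\<close> (\<open>coindependent_sequence_complete\<close>). This is why the \<open>y\<^sub>i\<close> exist.
  \<^item> It yields supplements: with \<open>L\<close> the intersection of all \<open>K\<^sub>i\<close>, there is a submodule \<open>C\<close> minimal
    subject to \<open>L + C = N\<close> (\<open>minimal_supplement\<close>), and minimality makes \<open>C \<inter> L\<close> small in \<open>M\<close>. The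
    \<open>y\<^sub>i\<close> can be chosen inside \<open>C\<close>.
  \<^item> It shows that \<open>U\<close> is small (\<open>small_submodule_by_tails\<close>). Let \<open>U\<^sub>n\<close> be generated by the \<open>y\<^sub>i\<close> with
    \<open>i \<ge> n\<close>. Every \<open>y\<^sub>i\<close> lies in \<open>Rad M\<close>, hence in a small submodule, so \<open>U + Y = M\<close> forces
    \<open>U\<^sub>n + Y = M\<close> for all \<open>n\<close>, and hence \<open>Y\<close> plus the intersection of the \<open>U\<^sub>n\<close> is \<open>M\<close>. That
    intersection lies in the small submodule \<open>C \<inter> L\<close>, and therefore \<open>Y = M\<close>.

  The characterisation of finite hollow dimension is the dual of the theory of uniform dimension.
  It uses only that submodules form a modular lattice: the Steinitz exchange argument (\<open>exchange\<close>)
  shows that a finite hollow decomposition excludes coindependent sequences, and a greedy choice of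
  hollow factor modules gives the converse (\<open>finite_hollow_decomposition_exists\<close>).
\<close>

section \<open>Dual Goldie dimension in modular lattices\<close>

text \<open>
  The meets of the lattices considered here are intersections, so that only the join is a parameter
  besides the carrier. Keeping the join abstract lets the same lattice theory serve a module and each
  of its submodules, regarded as modules in their own right.
\<close>

locale modular_set_lattice =
  fixes S :: "'a set set" and X :: "'a set" and join :: "'a set \<Rightarrow> 'a set \<Rightarrow> 'a set" (infixl \<open>\<uplus>\<close> 65)
  assumes top_mem: "X \<in> S"
    and le_top: "A \<in> S \<Longrightarrow> A \<subseteq> X"
    and inter_mem: "\<lbrakk>A \<in> S; B \<in> S\<rbrakk> \<Longrightarrow> A \<inter> B \<in> S"
    and join_mem: "\<lbrakk>A \<in> S; B \<in> S\<rbrakk> \<Longrightarrow> A \<uplus> B \<in> S"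
    and join_upper1: "\<lbrakk>A \<in> S; B \<in> S\<rbrakk> \<Longrightarrow> A \<subseteq> A \<uplus> B"
    and join_upper2: "\<lbrakk>A \<in> S; B \<in> S\<rbrakk> \<Longrightarrow> B \<subseteq> A \<uplus> B"
    and join_least: "\<lbrakk>A \<in> S; B \<in> S; C \<in> S; A \<subseteq> C; B \<subseteq> C\<rbrakk> \<Longrightarrow> A \<uplus> B \<subseteq> C"
    and modular: "\<lbrakk>A \<in> S; B \<in> S; C \<in> S; A \<subseteq> C\<rbrakk> \<Longrightarrow> (A \<uplus> B) \<inter> C \<subseteq> A \<uplus> (B \<inter> C)"
begin

text \<open>
  Intersecting with the top element makes the meet of the empty family equal to it.
\<close>

definition meet :: "'i set \<Rightarrow> ('i \<Rightarrow> 'a set) \<Rightarrow> 'a set"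
  where "meet J B = X \<inter> (\<Inter>j\<in>J. B j)"

definition coindependent :: "'i set \<Rightarrow> ('i \<Rightarrow> 'a set) \<Rightarrow> bool"
  where "coindependent J B \<longleftrightarrow> (\<forall>i\<in>J. B i \<uplus> meet (J - {i}) B = X)"

text \<open>
  In terms of modules: the image \<open>(D + E) / E\<close> of \<open>D\<close> is small in \<open>X / E\<close>.
\<close>

definition small_modulo :: "'a set \<Rightarrow> 'a set \<Rightarrow> bool"
  where "small_modulo E D \<longleftrightarrow> (\<forall>Y\<in>S. E \<subseteq> Y \<longrightarrow> D \<uplus> Y = X \<longrightarrow> Y = X)"

definition small :: "'a set \<Rightarrow> bool"
  where "small D \<longleftrightarrow> (\<forall>Y\<in>S. D \<uplus> Y = X \<longrightarrow> Y = X)"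

text \<open>
  In terms of modules: the factor module \<open>X / L\<close> is hollow.
\<close>

definition hollow_above :: "'a set \<Rightarrow> bool"
  where "hollow_above L \<longleftrightarrow> L \<in> S \<and> L \<noteq> X \<and>
    (\<forall>A\<in>S. \<forall>B\<in>S. L \<subseteq> A \<longrightarrow> L \<subseteq> B \<longrightarrow> A \<uplus> B = X \<longrightarrow> A = X \<or> B = X)"

definition coindependent_sequence :: "(nat \<Rightarrow> 'a set) \<Rightarrow> bool"
  where "coindependent_sequence K \<longleftrightarrow>
    (\<forall>i. K i \<in> S \<and> K i \<noteq> X) \<and> (\<forall>n. coindependent {..<n} K)"

definition finite_hollow_decomposition :: "nat \<Rightarrow> (nat \<Rightarrow> 'a set) \<Rightarrow> bool"
  where "finite_hollow_decomposition n L \<longleftrightarrow>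
    (\<forall>i<n. hollow_above (L i)) \<and> coindependent {..<n} L \<and> small (meet {..<n} L)"

lemma join_eq_topI: "\<lbrakk>A \<in> S; B \<in> S; X \<subseteq> A \<uplus> B\<rbrakk> \<Longrightarrow> A \<uplus> B = X"
  using join_mem le_top by blast

lemma join_commute: "\<lbrakk>A \<in> S; B \<in> S\<rbrakk> \<Longrightarrow> A \<uplus> B = B \<uplus> A"
  by (intro equalityI join_least join_mem join_upper1 join_upper2)

lemma join_mono: 
  assumes "A \<in> S" "B \<in> S" "C \<in> S" "D \<in> S" "A \<subseteq> C" "B \<subseteq> D"
  shows "A \<uplus> B \<subseteq> C \<uplus> D"
  using assms join_upper1[of C D] join_upper2[of C D]
  by (intro join_least join_mem) auto

lemma meet_mem: "\<lbrakk>finite J; \<And>j. j \<in> J \<Longrightarrow> B j \<in> S\<rbrakk> \<Longrightarrow> meet J B \<in> S"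
proof (induction J rule: finite_induct)
  case empty
  then show ?case by (simp add: meet_def top_mem)
next
  case (insert k J)
  then have "B k \<inter> meet J B \<in> S" by (intro inter_mem) auto
  moreover have "meet (insert k J) B = B k \<inter> meet J B" by (auto simp: meet_def)
  ultimately show ?case by simp
qed

lemma meet_insert: "meet (insert k J) B = B k \<inter> meet J B"
  by (auto simp: meet_def)

lemma meet_antimono: "J \<subseteq> I \<Longrightarrow> meet I B \<subseteq> meet J B"
  by (auto simp: meet_def)

lemma meet_cong: "(\<And>j. j \<in> J \<Longrightarrow> B j = C j) \<Longrightarrow> meet J B = meet J C"
  by (auto simp: meet_def)

lemma coindependent_subset:
  assumes "finite I" "J \<subseteq> I" "\<And>i. i \<in> I \<Longrightarrow> B i \<in> S" "coindependent I B"
  shows "coindependent J B"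
  unfolding coindependent_def
proof
  fix i assume i: "i \<in> J"
  then have "X = B i \<uplus> meet (I - {i}) B"
    using assms by (auto simp: coindependent_def)
  also have "\<dots> \<subseteq> B i \<uplus> meet (J - {i}) B"
    using assms i finite_subset[OF assms(2,1)]
    by (intro join_mono meet_mem meet_antimono) auto
  finally show "B i \<uplus> meet (J - {i}) B = X"
    using assms i finite_subset[OF assms(2,1)]
    by (intro join_eq_topI meet_mem) auto
qed

text \<open>
  For an old index \<open>i\<close>, let \<open>D\<close> be the meet over the other old indices. Since \<open>B k\<close> together with
  \<open>B i \<inter> D\<close> is everything, the modular law splits \<open>D\<close> into \<open>B i \<inter> D\<close> and \<open>B k \<inter> D\<close>; the first part is
  absorbed by \<open>B i\<close>. Consequently coindependence can be checked by adding the members one at a time.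
\<close>

lemma coindependent_insert:
  assumes J: "finite J" "k \<notin> J" and mem: "\<And>i. i \<in> insert k J \<Longrightarrow> B i \<in> S"
    and co: "coindependent J B" and k: "B k \<uplus> meet J B = X"
  shows "coindependent (insert k J) B"
  unfolding coindependent_def
proof
  fix i assume i: "i \<in> insert k J"
  show "B i \<uplus> meet (insert k J - {i}) B = X"
  proof (cases "i = k")
    case True
    with J k show ?thesis by (simp add: insert_Diff_if)
  next
    case False
    define D where "D = meet (J - {i}) B"
    have iJ: "i \<in> J" using i False by simp
    have D: "D \<in> S" unfolding D_def using J mem by (intro meet_mem) auto
    have Bi: "B i \<in> S" and Bk: "B k \<in> S" using mem iJ by auto
    have "meet J B = B i \<inter> D"
      using meet_insert[of i "J - {i}" B] iJ by (simp add: D_def insert_absorb)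
    then have kX: "B k \<uplus> (B i \<inter> D) = X" using k by simp
    have "D \<subseteq> (B i \<inter> D \<uplus> B k) \<inter> D"
      using kX le_top[OF D] join_commute[OF Bk inter_mem[OF Bi D]] by auto
    also have "\<dots> \<subseteq> B i \<inter> D \<uplus> (B k \<inter> D)"
      by (intro modular inter_mem Bi Bk D) auto
    also have "\<dots> \<subseteq> B i \<uplus> (B k \<inter> D)"
      by (intro join_mono inter_mem Bi Bk D) auto
    finally have "B i \<uplus> D \<subseteq> B i \<uplus> (B k \<inter> D)"
      by (intro join_least join_mem join_upper1 inter_mem Bi Bk D)
    moreover have "B i \<uplus> D = X"
      using co iJ by (auto simp: coindependent_def D_def)
    moreover have "meet (insert k J - {i}) B = B k \<inter> D"
      using False by (simp add: insert_Diff_if D_def meet_insert)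
    ultimately show ?thesis
      by (simp add: join_eq_topI inter_mem Bi Bk D)
  qed
qed

text \<open>
  When \<open>E\<close> and \<open>L\<close> are comaximal, \<open>X / (E \<inter> L)\<close> is the direct sum of \<open>E / (E \<inter> L)\<close> and
  \<open>L / (E \<inter> L)\<close>, and the first summand is isomorphic to \<open>X / L\<close>. The lemma says that this isomorphism
  carries the small image of \<open>D\<close> in \<open>X / L\<close> to a small submodule.
\<close>

lemma small_modulo_component:
  assumes E: "E \<in> S" and L: "L \<in> S" and D: "D \<in> S"
    and EL: "E \<uplus> L = X" and small: "small_modulo L D"
  shows "small_modulo (E \<inter> L) ((D \<uplus> L) \<inter> E)"
  unfolding small_modulo_def
proof (intro ballI impI)
  fix Y assume Y: "Y \<in> S" "E \<inter> L \<subseteq> Y" and X: "(D \<uplus> L) \<inter> E \<uplus> Y = X"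
  define T where "T = (D \<uplus> L) \<inter> E"
  define Z where "Z = Y \<inter> E \<uplus> L"
  have T: "T \<in> S" and Z: "Z \<in> S" and YE: "Y \<inter> E \<in> S" and DZ: "D \<uplus> Z \<in> S"
    unfolding T_def Z_def by (intro inter_mem join_mem E L D Y)+
  have LZ: "L \<subseteq> Z" "Y \<inter> E \<subseteq> Z"
    unfolding Z_def by (intro join_upper1 join_upper2 YE L)+
  have "T \<subseteq> D \<uplus> Z"
    using join_mono[OF D L D Z order_refl LZ(1)] by (auto simp: T_def)
  moreover have ZDZ: "Z \<subseteq> D \<uplus> Z" by (rule join_upper2[OF D Z])
  moreover have "E \<subseteq> (T \<uplus> Y) \<inter> E"
    using X le_top[OF E] by (auto simp: T_def)
  moreover have "(T \<uplus> Y) \<inter> E \<subseteq> T \<uplus> (Y \<inter> E)"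
    by (intro modular T Y E) (auto simp: T_def)
  ultimately have "E \<subseteq> D \<uplus> Z"
    using join_least[OF T YE DZ] LZ by blast
  then have "X \<subseteq> D \<uplus> Z"
    using join_least[OF E L DZ] LZ ZDZ EL by blast
  then have "Z = X"
    using small Z LZ join_eq_topI[OF D Z] unfolding small_modulo_def by blast
  then have "E \<subseteq> (Y \<inter> E \<uplus> L) \<inter> E" using le_top[OF E] by (auto simp: Z_def)
  also have "\<dots> \<subseteq> Y \<inter> E \<uplus> (L \<inter> E)" by (intro modular YE L E) auto
  also have "\<dots> \<subseteq> Y" using Y by (intro join_least YE L E inter_mem) auto
  finally have "T \<subseteq> Y" by (auto simp: T_def)
  then have "T \<uplus> Y \<subseteq> Y" by (intro join_least T Y) auto
  with X Y(1) le_top show "Y = X" by (auto simp: T_def)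
qed

text \<open>
  In the direct sum \<open>X / (E \<inter> L)\<close> the image of \<open>D\<close> is contained in the sum of its two projections
  \<open>T1\<close> and \<open>T2\<close>, each of which is small by the previous lemma; and a sum of two small submodules is small.
\<close>

lemma small_modulo_inter:
  assumes E: "E \<in> S" and L: "L \<in> S" and D: "D \<in> S"
    and EL: "E \<uplus> L = X" and sE: "small_modulo E D" and sL: "small_modulo L D"
  shows "small_modulo (E \<inter> L) D"
  unfolding small_modulo_def
proof (intro ballI impI)
  fix Y assume Y: "Y \<in> S" "E \<inter> L \<subseteq> Y" and X: "D \<uplus> Y = X"
  define T1 where "T1 = (D \<uplus> L) \<inter> E"
  define T2 where "T2 = (D \<uplus> E) \<inter> L"
  have LE: "L \<uplus> E = X" using EL join_commute[OF E L] by simp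
  have T1: "T1 \<in> S" and T2: "T2 \<in> S" and DL: "D \<uplus> L \<in> S" and DE: "D \<uplus> E \<in> S"
    unfolding T1_def T2_def by (intro inter_mem join_mem E L D)+
  have s1: "small_modulo (E \<inter> L) T1" and s2: "small_modulo (E \<inter> L) T2"
    using small_modulo_component[OF E L D EL sL] small_modulo_component[OF L E D LE sE]
    by (simp_all add: T1_def T2_def Int_commute)
  have "D \<uplus> E \<subseteq> (E \<uplus> L) \<inter> (D \<uplus> E)" using EL le_top[OF DE] by auto
  also have "\<dots> \<subseteq> E \<uplus> (L \<inter> (D \<uplus> E))" by (intro modular E L DE join_upper2 D)
  also have "\<dots> = T2 \<uplus> E" 
    using join_commute[OF E T2] by (simp add: T2_def Int_commute)
  finally have "D \<subseteq> (T2 \<uplus> E) \<inter> (D \<uplus> L)"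
    using join_upper1[OF D E] join_upper1[OF D L] by auto
  also have "\<dots> \<subseteq> T2 \<uplus> (E \<inter> (D \<uplus> L))"
    using join_upper2[OF D L] by (intro modular T2 E DL) (auto simp: T2_def)
  also have "\<dots> = T1 \<uplus> T2" using join_commute[OF T1 T2] by (simp add: T1_def Int_commute)
  finally have "D \<subseteq> T1 \<uplus> T2" .
  moreover have "T1 \<uplus> T2 \<subseteq> T1 \<uplus> (T2 \<uplus> Y)"
    by (intro join_mono T1 T2 join_mem Y join_upper1 order_refl)
  moreover have "Y \<subseteq> T1 \<uplus> (T2 \<uplus> Y)"
    using join_upper2[OF T2 Y(1)] join_upper2[OF T1 join_mem[OF T2 Y(1)]] by blast
  ultimately have "D \<uplus> Y \<subseteq> T1 \<uplus> (T2 \<uplus> Y)"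
    by (intro join_least D Y join_mem T1 T2) auto
  then have "T1 \<uplus> (T2 \<uplus> Y) = X"
    using X by (intro join_eq_topI T1 T2 Y join_mem) auto
  moreover have "E \<inter> L \<subseteq> T2 \<uplus> Y" using Y join_upper2[OF T2 Y(1)] by blast
  ultimately have "T2 \<uplus> Y = X"
    using s1 join_mem[OF T2 Y(1)] unfolding small_modulo_def by blast
  then show "Y = X" using s2 Y unfolding small_modulo_def by blast
qed

lemma hollow_above_small_modulo:
  assumes L: "hollow_above L" and D: "D \<in> S" and ne: "L \<uplus> D \<noteq> X"
  shows "small_modulo L D"
  unfolding small_modulo_def
proof (intro ballI impI)
  fix Y assume Y: "Y \<in> S" "L \<subseteq> Y" "D \<uplus> Y = X"
  have LS: "L \<in> S" using L by (simp add: hollow_above_def)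
  have "D \<uplus> Y \<subseteq> (L \<uplus> D) \<uplus> Y"
    by (intro join_mono join_mem join_upper2 D LS Y order_refl)
  then have "(L \<uplus> D) \<uplus> Y = X" using Y by (intro join_eq_topI join_mem D LS Y) auto
  then show "Y = X"
    using L Y ne join_mem[OF LS D] join_upper1[OF LS D] unfolding hollow_above_def by blast
qed

lemma small_modulo_meet:
  assumes "finite J" "\<And>i. i \<in> J \<Longrightarrow> hollow_above (L i)" "coindependent J L"
    and "D \<in> S" "\<And>i. i \<in> J \<Longrightarrow> L i \<uplus> D \<noteq> X"
  shows "small_modulo (meet J L) D"
  using assms
proof (induction J rule: finite_induct)
  case empty
  then show ?case using le_top by (auto simp: meet_def small_modulo_def)
next
  case (insert k J)
  have mem: "\<And>i. i \<in> insert k J \<Longrightarrow> L i \<in> S"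
    using insert.prems by (auto simp: hollow_above_def)
  have E: "meet J L \<in> S" using mem insert.hyps by (intro meet_mem) auto
  have "small_modulo (meet J L) D"
    using insert.prems insert.hyps mem
    by (intro insert.IH coindependent_subset[of "insert k J" J]) auto
  moreover have "small_modulo (L k) D"
    using insert.prems by (intro hollow_above_small_modulo) auto
  moreover have "L k \<uplus> meet J L = X"
    using insert.prems(2) insert.hyps by (auto simp: coindependent_def)
  ultimately have "small_modulo (L k \<inter> meet J L) D"
    using insert.prems mem E by (intro small_modulo_inter) auto
  then show ?case by (simp add: meet_insert)
qed

text \<open>
  This is the dual of the fact that a submodule that meets every summand of an essential direct sum of
  uniform modules is itself essential: if \<open>D\<close> were proper modulo every \<open>L i\<close>, it would be small modulo
  every \<open>L i\<close>, hence modulo their meet, and this meet is small.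
\<close>

lemma not_small_avoids_component:
  assumes L: "finite_hollow_decomposition n L" and D: "D \<in> S" and not_small: "\<not> small D"
  shows "\<exists>i<n. L i \<uplus> D = X"
proof (rule ccontr)
  assume none: "\<not> (\<exists>i<n. L i \<uplus> D = X)"
  let ?E = "meet {..<n} L"
  have E: "?E \<in> S"
    using L by (intro meet_mem) (auto simp: finite_hollow_decomposition_def hollow_above_def)
  have mod: "small_modulo ?E D"
    using L D none by (intro small_modulo_meet) (auto simp: finite_hollow_decomposition_def)
  have "small D"
    unfolding small_def
  proof (intro ballI impI)
    fix Y assume Y: "Y \<in> S" "D \<uplus> Y = X"
    have "D \<uplus> Y \<subseteq> D \<uplus> (?E \<uplus> Y)"
      by (intro join_mono join_mem join_upper2 D E Y order_refl)
    then have "D \<uplus> (?E \<uplus> Y) = X" using Y by (intro join_eq_topI join_mem D E Y) auto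
    then have "?E \<uplus> Y = X"
      using mod join_mem[OF E Y(1)] join_upper1[OF E Y(1)] unfolding small_modulo_def by blast
    then show "Y = X"
      using L Y by (auto simp: finite_hollow_decomposition_def small_def)
  qed
  with not_small show False by simp
qed

text \<open>
  Steinitz exchange. The members of a coindependent family of proper elements are replaced one after
  the other by members of the decomposition. When \<open>A k\<close> is to be replaced, the meet \<open>D\<close> of all other
  current members is not small, since it adds up to \<open>X\<close> with the proper element \<open>A k\<close>; so some \<open>L i\<close>
  adds up to \<open>X\<close> with \<open>D\<close> and can take its place.
\<close>

lemma exchange:
  fixes k m n :: nat
  assumes L: "finite_hollow_decomposition n L"
    and A: "\<And>i. A i \<in> S \<and> A i \<noteq> X" and co: "coindependent {..<m} A" and k: "k \<le> m"
  shows "\<exists>c. (\<forall>j<k. c j < n) \<and> coindependent {..<m} (\<lambda>j. if j < k then L (c j) else A j)"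
  using k
proof (induction k)
  case 0
  then show ?case using co by simp
next
  case (Suc k)
  then obtain c where c: "\<forall>j<k. c j < n"
    and co: "coindependent {..<m} (\<lambda>j. if j < k then L (c j) else A j)" by auto
  define B where "B = (\<lambda>j. if j < k then L (c j) else A j)"
  have LS: "i < n \<Longrightarrow> L i \<in> S" for i
    using L by (auto simp: finite_hollow_decomposition_def hollow_above_def)
  have BS: "B j \<in> S" for j using A LS c by (auto simp: B_def)
  define J where "J = {..<m} - {k}"
  have J: "finite J" "k \<notin> J" "insert k J = {..<m}" using Suc.prems by (auto simp: J_def)
  define D where "D = meet J B"
  have D: "D \<in> S" unfolding D_def using BS J by (intro meet_mem) auto
  have "B k \<uplus> meet ({..<m} - {k}) B = X"
    using co Suc.prems unfolding coindependent_def B_def[symmetric] by simp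
  then have "A k \<uplus> D = X" unfolding D_def J_def by (simp add: B_def)
  then have "\<not> small D"
    using A[of k] join_commute[OF D] by (auto simp: small_def)
  then obtain i where i: "i < n" "L i \<uplus> D = X"
    using not_small_avoids_component[OF L D] by blast
  define c' where "c' = c(k := i)"
  define B' where "B' = (\<lambda>j. if j < Suc k then L (c' j) else A j)"
  have BB': "B' j = B j" if "j \<in> J" for j
    using that J by (auto simp: B_def B'_def c'_def less_Suc_eq)
  have "coindependent J B"
    using co J BS by (intro coindependent_subset[of "{..<m}" J]) (auto simp: B_def J_def)
  then have "coindependent J B'"
    using BB' meet_cong[of "J - {j}" B' B for j] by (auto simp: coindependent_def)
  moreover have "B' k \<uplus> meet J B' = X"
    using i meet_cong[of J B' B] BB' by (simp add: B'_def c'_def D_def)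
  moreover have "B' j \<in> S" for j
    using A LS c i by (auto simp: B'_def c'_def less_Suc_eq)
  ultimately have "coindependent {..<m} B'"
    using J coindependent_insert[of J k B'] by simp
  moreover have "\<forall>j<Suc k. c' j < n" using c i by (auto simp: c'_def less_Suc_eq)
  ultimately show ?case unfolding B'_def by blast
qed

text \<open>
  Exchanging \<open>n + 1\<close> members for members of a decomposition of length \<open>n\<close> uses some \<open>L i\<close> twice, and an
  \<open>L i\<close> that is comaximal with itself is not proper.
\<close>

lemma no_coindependent_sequence:
  assumes L: "finite_hollow_decomposition n L"
  shows "\<not> coindependent_sequence A"
proof
  assume A: "coindependent_sequence A"
  then obtain c where c: "\<forall>j<Suc n. c j < n"
    and co: "coindependent {..<Suc n} (\<lambda>j. if j < Suc n then L (c j) else A j)"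
    using exchange[OF L, of A "Suc n" "Suc n"] by (auto simp: coindependent_sequence_def)
  have LS: "i < n \<Longrightarrow> L i \<in> S \<and> L i \<noteq> X" for i
    using L by (auto simp: finite_hollow_decomposition_def hollow_above_def)
  have "\<not> inj_on c {..<Suc n}"
  proof
    assume "inj_on c {..<Suc n}"
    then have "card {..<Suc n} \<le> card {..<n}"
      using c by (intro card_inj_on_le[of c]) auto
    then show False by simp
  qed
  then obtain i j where ij: "i < Suc n" "j < Suc n" "i \<noteq> j" "c i = c j"
    by (auto simp: inj_on_def)
  define B where "B = (\<lambda>j. if j < Suc n then L (c j) else A j)"
  have BS: "B i \<in> S" for i
    using LS c A by (auto simp: B_def coindependent_sequence_def)
  have X: "B i \<uplus> meet ({..<Suc n} - {i}) B = X"
    using co ij(1) unfolding coindependent_def B_def[symmetric] by blast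
  have "meet ({..<Suc n} - {i}) B \<subseteq> B i"
    using ij by (auto simp: meet_def B_def)
  then have "B i \<uplus> meet ({..<Suc n} - {i}) B \<subseteq> B i"
    using BS by (intro join_least meet_mem) auto
  then have "B i = X" using X le_top[OF BS] by blast
  then show False using LS c ij by (auto simp: B_def)
qed

text \<open>
  Suppose nothing above \<open>B0\<close> is hollow. Then every proper \<open>B\<close> above \<open>B0\<close> lies in two comaximal proper
  elements \<open>a B\<close> and \<open>b B\<close>. Iterating \<open>b\<close> gives an ascending chain \<open>C n\<close>, and the elements \<open>a (C n)\<close> form
  a coindependent sequence: all later ones contain \<open>C (n + 1)\<close>, which is comaximal with \<open>a (C n)\<close>.
\<close>

lemma hollow_above_exists:
  assumes none: "\<And>K. \<not> coindependent_sequence K" and B0: "B0 \<in> S" "B0 \<noteq> X"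
  shows "\<exists>L. hollow_above L \<and> B0 \<subseteq> L"
proof (rule ccontr)
  assume no: "\<not> ?thesis"
  have "\<exists>A B'. A \<in> S \<and> A \<noteq> X \<and> B' \<in> S \<and> B' \<noteq> X \<and> B \<subseteq> A \<and> B \<subseteq> B' \<and> A \<uplus> B' = X"
    if "B \<in> S" "B \<noteq> X" "B0 \<subseteq> B" for B
    using that no unfolding hollow_above_def by blast
  then obtain a b where ab: "\<And>B. B \<in> S \<Longrightarrow> B \<noteq> X \<Longrightarrow> B0 \<subseteq> B \<Longrightarrow>
      a B \<in> S \<and> a B \<noteq> X \<and> b B \<in> S \<and> b B \<noteq> X \<and> B \<subseteq> a B \<and> B \<subseteq> b B \<and> a B \<uplus> b B = X"
    by metis
  define C where "C = (\<lambda>n. (b ^^ n) B0)"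
  define K where "K = (\<lambda>n. a (C n))"
  have C: "C n \<in> S \<and> C n \<noteq> X \<and> B0 \<subseteq> C n" for n
  proof (induction n)
    case 0
    then show ?case using B0 by (simp add: C_def)
  next
    case (Suc n)
    then show ?case using ab[of "C n"] by (auto simp: C_def)
  qed
  have KC: "K n \<in> S" "K n \<noteq> X" "C n \<subseteq> K n" "C n \<subseteq> C (Suc n)" "K n \<uplus> C (Suc n) = X" for n
    using ab[of "C n"] C[of n] by (simp_all add: K_def C_def)
  have Cmono: "C n \<subseteq> C m" if "n \<le> m" for n m
    using that KC(4) by (rule lift_Suc_mono_le[rotated])
  \<comment> \<open>The induction adds members in front, because \<open>K n\<close> is related to the later members only.\<close>
  have "coindependent {n..<m} K" if "n \<le> m" for n m
    using that
  proof (induction rule: inc_induct)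
    case base
    then show ?case by (simp add: coindependent_def)
  next
    case (step n)
    have le: "C (Suc n) \<subseteq> meet {Suc n..<m} K"
      using C Cmono KC(3) le_top by (fastforce simp: meet_def)
    have mem: "meet {Suc n..<m} K \<in> S" using KC by (intro meet_mem) auto
    have "K n \<uplus> C (Suc n) \<subseteq> K n \<uplus> meet {Suc n..<m} K"
      using le mem KC C by (intro join_mono) auto
    then have "K n \<uplus> meet {Suc n..<m} K = X"
      using KC mem by (intro join_eq_topI) auto
    then have "coindependent (insert n {Suc n..<m}) K"
      using step KC by (intro coindependent_insert) auto
    moreover have "insert n {Suc n..<m} = {n..<m}" using step by auto
    ultimately show ?case by simp
  qed
  from this[of 0] have "coindependent_sequence K"
    using KC by (simp add: coindependent_sequence_def atLeast0LessThan)
  with none show False by blast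
qed

text \<open>
  As long as the meet \<open>E n\<close> of the elements chosen so far is not small, it is comaximal with some proper
  element, and enlarging that element gives a hollow one comaximal with \<open>E n\<close>, which is
  chosen next. The choices are coindependent, so the process stops at a small meet.
\<close>

lemma finite_hollow_decomposition_exists:
  assumes none: "\<And>K. \<not> coindependent_sequence K"
  shows "\<exists>n L. finite_hollow_decomposition n L"
proof -
  have "\<exists>L. hollow_above L \<and> L \<uplus> D = X" if D: "D \<in> S" "\<not> small D" for D
  proof -
    obtain A where A: "A \<in> S" "A \<noteq> X" "D \<uplus> A = X" using D by (auto simp: small_def)
    obtain L where L: "hollow_above L" "A \<subseteq> L" using hollow_above_exists[OF none A(1,2)] by blast
    have LS: "L \<in> S" using L by (simp add: hollow_above_def)
    have "D \<uplus> A \<subseteq> L \<uplus> D"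
      using join_mono[OF D(1) A(1) D(1) LS] L join_commute[OF D(1) LS] by auto
    then show ?thesis using L A join_eq_topI[OF LS D(1)] by auto
  qed
  then obtain h where h: "\<And>D. D \<in> S \<Longrightarrow> \<not> small D \<Longrightarrow> hollow_above (h D) \<and> h D \<uplus> D = X"
    by metis
  define E where "E = rec_nat X (\<lambda>_ D. h D \<inter> D)"
  have E0: "E 0 = X" and ES: "E (Suc n) = h (E n) \<inter> E n" for n by (simp_all add: E_def)
  define K where "K = (\<lambda>n. h (E n))"
  have meetK: "E n = meet {..<n} K" for n
    by (induction n) (auto simp: E0 ES meet_def K_def lessThan_Suc)
  have co: "(\<forall>i<n. hollow_above (K i)) \<and> coindependent {..<n} K \<and> E n \<in> S"
    if "\<And>i. i < n \<Longrightarrow> \<not> small (E i)" for n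
    using that
  proof (induction n)
    case 0
    then show ?case by (simp add: coindependent_def E0 top_mem)
  next
    case (Suc n)
    then have IH: "\<forall>i<n. hollow_above (K i)" "coindependent {..<n} K" "E n \<in> S" by auto
    have K: "hollow_above (K n)" "K n \<uplus> meet {..<n} K = X"
      using h[OF IH(3)] Suc.prems[of n] unfolding meetK[symmetric] by (simp_all add: K_def)
    have mem: "i \<in> insert n {..<n} \<Longrightarrow> K i \<in> S" for i
      using K IH by (auto simp: hollow_above_def)
    then have "coindependent (insert n {..<n}) K"
      using K IH by (intro coindependent_insert) auto
    moreover have "E (Suc n) = K n \<inter> E n" by (simp add: ES K_def)
    ultimately show ?case
      using K(1) IH mem[of n] inter_mem[of "K n" "E n"] by (simp add: lessThan_Suc less_Suc_eq)
  qed
  have "\<exists>n. small (E n)"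
  proof (rule ccontr)
    assume "\<not> ?thesis"
    then have "hollow_above (K i)" "coindependent {..<i} K" for i
      using co[of "Suc i"] co[of i] by auto
    then have "coindependent_sequence K"
      by (simp add: coindependent_sequence_def hollow_above_def)
    with none show False by blast
  qed
  then obtain n where n: "small (E n)" "\<And>i. i < n \<Longrightarrow> \<not> small (E i)"
    using exists_least_iff[of "\<lambda>n. small (E n)"] by blast
  then have "finite_hollow_decomposition n K"
    using co[of n] by (simp add: finite_hollow_decomposition_def flip: meetK)
  then show ?thesis by blast
qed

end


section \<open>Submodule lattices and finite hollow dimension\<close>

lemma mem_set_add: "x \<in> A <+>\<^bsub>M\<^esub> B \<longleftrightarrow> (\<exists>a\<in>A. \<exists>b\<in>B. x = a \<oplus>\<^bsub>M\<^esub> b)"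
  by (auto simp: set_add_def' )

context left_module
begin

lemma smult_zero:
  assumes "a \<in> carrier R"
  shows "a \<odot>\<^bsub>M\<^esub> \<zero>\<^bsub>M\<^esub> = \<zero>\<^bsub>M\<^esub>"
proof -
  have "a \<odot>\<^bsub>M\<^esub> \<zero>\<^bsub>M\<^esub> \<oplus>\<^bsub>M\<^esub> a \<odot>\<^bsub>M\<^esub> \<zero>\<^bsub>M\<^esub> = a \<odot>\<^bsub>M\<^esub> \<zero>\<^bsub>M\<^esub>"
    using assms smult_r_distr[of a "\<zero>\<^bsub>M\<^esub>" "\<zero>\<^bsub>M\<^esub>"] by simp
  then show ?thesis
    using assms M.add.r_cancel_one smult_closed[OF assms M.zero_closed] by simp
qed

lemma submodule_iff:
  "submodule N R M \<longleftrightarrow> N \<subseteq> carrier M \<and> \<zero>\<^bsub>M\<^esub> \<in> N \<and> (\<forall>x\<in>N. \<forall>y\<in>N. x \<oplus>\<^bsub>M\<^esub> y \<in> N)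
    \<and> (\<forall>x\<in>N. \<ominus>\<^bsub>M\<^esub> x \<in> N) \<and> (\<forall>a\<in>carrier R. \<forall>x\<in>N. a \<odot>\<^bsub>M\<^esub> x \<in> N)"
  by (auto simp: submodule_def submodule_axioms_def subgroup_def a_inv_def)

lemma submodule_carrier: "submodule (carrier M) R M"
  by (simp add: submodule_iff)

lemma submodule_subset: "submodule N R M \<Longrightarrow> x \<in> N \<Longrightarrow> x \<in> carrier M"
  by (auto simp: submodule_iff)

lemma submodule_minus:
  "\<lbrakk>submodule N R M; x \<in> N; y \<in> N\<rbrakk> \<Longrightarrow> x \<ominus>\<^bsub>M\<^esub> y \<in> N"
  by (simp add: submodule_iff a_minus_def)

lemma minus_add_cancel:
  assumes "x \<in> carrier M" "y \<in> carrier M"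
  shows "(x \<ominus>\<^bsub>M\<^esub> y) \<oplus>\<^bsub>M\<^esub> y = x" "y \<oplus>\<^bsub>M\<^esub> (x \<ominus>\<^bsub>M\<^esub> y) = x" "(y \<oplus>\<^bsub>M\<^esub> x) \<ominus>\<^bsub>M\<^esub> y = x"
proof -
  show *: "(x \<ominus>\<^bsub>M\<^esub> y) \<oplus>\<^bsub>M\<^esub> y = x" using assms by (simp add: a_minus_def M.a_assoc M.l_neg)
  then show "y \<oplus>\<^bsub>M\<^esub> (x \<ominus>\<^bsub>M\<^esub> y) = x" using assms by (simp add: M.a_comm[of y])
  then show "(y \<oplus>\<^bsub>M\<^esub> x) \<ominus>\<^bsub>M\<^esub> y = x" using assms by (simp add: a_minus_def M.a_assoc)
qed

lemma submodule_Inter: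
  assumes "F \<noteq> {}" "\<And>A. A \<in> F \<Longrightarrow> submodule A R M"
  shows "submodule (\<Inter>F) R M"
  using assms by (fastforce simp: submodule_iff)

lemma submodule_Int:
  "\<lbrakk>submodule A R M; submodule B R M\<rbrakk> \<Longrightarrow> submodule (A \<inter> B) R M"
  using submodule_Inter[of "{A, B}"] by auto

lemma submodule_set_add:
  assumes A: "submodule A R M" and B: "submodule B R M"
  shows "submodule (A <+>\<^bsub>M\<^esub> B) R M"
proof -
  note sub = submodule_subset[OF A] submodule_subset[OF B]
  have "\<exists>a'\<in>A. \<exists>b'\<in>B. (a \<oplus>\<^bsub>M\<^esub> b) \<oplus>\<^bsub>M\<^esub> (c \<oplus>\<^bsub>M\<^esub> d) = a' \<oplus>\<^bsub>M\<^esub> b'"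
    if "a \<in> A" "b \<in> B" "c \<in> A" "d \<in> B" for a b c d
    using that A B sub
    by (intro bexI[of _ "a \<oplus>\<^bsub>M\<^esub> c"] bexI[of _ "b \<oplus>\<^bsub>M\<^esub> d"]) (auto simp: M.a_ac submodule_iff)
  moreover have "\<exists>a'\<in>A. \<exists>b'\<in>B. \<ominus>\<^bsub>M\<^esub> (a \<oplus>\<^bsub>M\<^esub> b) = a' \<oplus>\<^bsub>M\<^esub> b'" if "a \<in> A" "b \<in> B" for a b
    using that A B sub
    by (intro bexI[of _ "\<ominus>\<^bsub>M\<^esub> a"] bexI[of _ "\<ominus>\<^bsub>M\<^esub> b"]) (auto simp: M.minus_add submodule_iff)
  moreover have "\<exists>a'\<in>A. \<exists>b'\<in>B. r \<odot>\<^bsub>M\<^esub> (a \<oplus>\<^bsub>M\<^esub> b) = a' \<oplus>\<^bsub>M\<^esub> b'"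
    if "r \<in> carrier R" "a \<in> A" "b \<in> B" for r a b
    using that A B sub
    by (intro bexI[of _ "r \<odot>\<^bsub>M\<^esub> a"] bexI[of _ "r \<odot>\<^bsub>M\<^esub> b"]) (auto simp: smult_r_distr submodule_iff)
  moreover have "\<zero>\<^bsub>M\<^esub> \<in> A <+>\<^bsub>M\<^esub> B"
    using A B by (auto simp: mem_set_add submodule_iff intro!: bexI[of _ "\<zero>\<^bsub>M\<^esub>"])
  moreover have "A <+>\<^bsub>M\<^esub> B \<subseteq> carrier M" using sub by (auto simp: mem_set_add)
  ultimately show ?thesis
    unfolding submodule_iff by (auto simp: mem_set_add)
qed

lemma set_add_upper1:
  assumes "submodule A R M" "submodule B R M"
  shows "A \<subseteq> A <+>\<^bsub>M\<^esub> B"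
proof
  fix x assume x: "x \<in> A"
  then have "x = x \<oplus>\<^bsub>M\<^esub> \<zero>\<^bsub>M\<^esub>" using submodule_subset[OF assms(1)] by simp
  moreover have "\<zero>\<^bsub>M\<^esub> \<in> B" using assms(2) by (simp add: submodule_iff)
  ultimately show "x \<in> A <+>\<^bsub>M\<^esub> B" using x unfolding mem_set_add by blast
qed

lemma set_add_upper2:
  assumes "submodule A R M" "submodule B R M"
  shows "B \<subseteq> A <+>\<^bsub>M\<^esub> B"
proof
  fix x assume x: "x \<in> B"
  then have "x = \<zero>\<^bsub>M\<^esub> \<oplus>\<^bsub>M\<^esub> x" using submodule_subset[OF assms(2)] by simp
  moreover have "\<zero>\<^bsub>M\<^esub> \<in> A" using assms(1) by (simp add: submodule_iff)
  ultimately show "x \<in> A <+>\<^bsub>M\<^esub> B" using x unfolding mem_set_add by blast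
qed

sublocale submodules: modular_set_lattice "{N. submodule N R M}" "carrier M" "set_add M"
proof (unfold_locales, unfold mem_Collect_eq)
  show "submodule (carrier M) R M" by (rule submodule_carrier)
  fix A assume A: "submodule A R M"
  then show "A \<subseteq> carrier M" by (simp add: submodule_iff)
  fix B assume B: "submodule B R M"
  show "submodule (A \<inter> B) R M" by (rule submodule_Int[OF A B])
  show "submodule (A <+>\<^bsub>M\<^esub> B) R M" by (rule submodule_set_add[OF A B])
  show "A \<subseteq> A <+>\<^bsub>M\<^esub> B" by (rule set_add_upper1[OF A B])
  show "B \<subseteq> A <+>\<^bsub>M\<^esub> B" by (rule set_add_upper2[OF A B])
  fix C assume C: "submodule C R M" and AC: "A \<subseteq> C"
  show "B \<subseteq> C \<Longrightarrow> A <+>\<^bsub>M\<^esub> B \<subseteq> C"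
    using C AC by (auto simp: mem_set_add submodule_iff subset_iff)
  show "(A <+>\<^bsub>M\<^esub> B) \<inter> C \<subseteq> A <+>\<^bsub>M\<^esub> (B \<inter> C)"
  proof
    fix x assume "x \<in> (A <+>\<^bsub>M\<^esub> B) \<inter> C"
    then obtain a b where ab: "a \<in> A" "b \<in> B" "x = a \<oplus>\<^bsub>M\<^esub> b" "x \<in> C" by (auto simp: mem_set_add)
    have [simp]: "a \<in> carrier M" "b \<in> carrier M"
      using ab submodule_subset[OF A] submodule_subset[OF B] by auto
    have "b = x \<ominus>\<^bsub>M\<^esub> a" by (simp add: ab minus_add_cancel)
    then have "b \<in> C" using submodule_minus[OF C] ab AC by (metis subsetD)
    then show "x \<in> A <+>\<^bsub>M\<^esub> (B \<inter> C)" using ab by (auto simp: mem_set_add)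
  qed
qed

lemma submodule_meet:
  "finite J \<Longrightarrow> (\<And>j. j \<in> J \<Longrightarrow> submodule (K j) R M) \<Longrightarrow> submodule (submodules.meet J K) R M"
  using submodules.meet_mem[of J K] by simp

lemma small_submodule_iff:
  "small_submodule R M N \<longleftrightarrow> submodule N R M \<and> submodules.small N"
  by (auto simp: small_submodule_def submodules.small_def)

lemma small_submodule_mono:
  assumes "small_submodule R M N" "submodule A R M" "A \<subseteq> N"
  shows "small_submodule R M A"
  unfolding small_submodule_def
proof (intro conjI allI impI assms)
  fix K assume K: "submodule K R M" "A <+>\<^bsub>M\<^esub> K = carrier M"
  have N: "submodule N R M" using assms by (simp add: small_submodule_def)
  have "A <+>\<^bsub>M\<^esub> K \<subseteq> N <+>\<^bsub>M\<^esub> K" using assms(3) unfolding subset_iff mem_set_add by blast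
  then have "N <+>\<^bsub>M\<^esub> K = carrier M"
    using submodules.join_eq_topI[of N K] N K by simp
  then show "K = carrier M" using assms K by (simp add: small_submodule_def)
qed

lemma set_add_assoc:
  assumes "submodule A R M" "submodule B R M" "submodule C R M"
  shows "(A <+>\<^bsub>M\<^esub> B) <+>\<^bsub>M\<^esub> C = A <+>\<^bsub>M\<^esub> (B <+>\<^bsub>M\<^esub> C)"
  unfolding set_add_def using assms
  by (intro M.add.set_mult_assoc) (auto simp: submodule_iff)

lemma small_submodule_set_add:
  assumes "small_submodule R M A" "small_submodule R M B"
  shows "small_submodule R M (A <+>\<^bsub>M\<^esub> B)"
  unfolding small_submodule_def
proof (intro conjI allI impI)
  have S: "submodule A R M" "submodule B R M" using assms by (simp_all add: small_submodule_def)
  then show "submodule (A <+>\<^bsub>M\<^esub> B) R M" by (rule submodule_set_add)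
  fix K assume K: "submodule K R M" "(A <+>\<^bsub>M\<^esub> B) <+>\<^bsub>M\<^esub> K = carrier M"
  then have "A <+>\<^bsub>M\<^esub> (B <+>\<^bsub>M\<^esub> K) = carrier M" using set_add_assoc[OF S K(1)] by simp
  then have "B <+>\<^bsub>M\<^esub> K = carrier M"
    using assms(1) submodule_set_add[OF S(2) K(1)] by (simp add: small_submodule_def)
  then show "K = carrier M" using assms(2) K(1) by (simp add: small_submodule_def)
qed

lemma left_module_submodule:
  assumes N: "submodule N R M"
  shows "left_module R (M\<lparr>carrier := N\<rparr>)"
proof -
  have sub: "x \<in> N \<Longrightarrow> x \<in> carrier M" for x using N by (rule submodule_subset)
  have "abelian_group (M\<lparr>carrier := N\<rparr>)"
  proof (rule abelian_groupI)
    fix x assume "x \<in> carrier (M\<lparr>carrier := N\<rparr>)"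
    then show "\<exists>y\<in>carrier (M\<lparr>carrier := N\<rparr>).
        y \<oplus>\<^bsub>M\<lparr>carrier := N\<rparr>\<^esub> x = \<zero>\<^bsub>M\<lparr>carrier := N\<rparr>\<^esub>"
      using N sub by (auto simp: submodule_iff M.l_neg intro!: bexI[of _ "\<ominus>\<^bsub>M\<^esub> x"])
  qed (use N sub in \<open>auto simp: submodule_iff M.a_ac\<close>)
  then show ?thesis
    using N sub R.ring_axioms
    by (auto simp: left_module_def left_module_axioms_def submodule_iff
        smult_l_distr smult_r_distr smult_assoc1)
qed

lemma submodule_restrict_iff:
  assumes N: "submodule N R M"
  shows "submodule A R (M\<lparr>carrier := N\<rparr>) \<longleftrightarrow> submodule A R M \<and> A \<subseteq> N"
proof -
  interpret N: left_module R "M\<lparr>carrier := N\<rparr>" using N by (rule left_module_submodule)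
  have "\<ominus>\<^bsub>M\<lparr>carrier := N\<rparr>\<^esub> x = \<ominus>\<^bsub>M\<^esub> x" if "x \<in> N" for x
    using that N N.M.minus_equality[of "\<ominus>\<^bsub>M\<^esub> x" x] submodule_subset[OF N]
    by (auto simp: submodule_iff M.l_neg)
  then show ?thesis
    using N unfolding N.submodule_iff submodule_iff by (auto simp: subset_iff)
qed

lemma set_add_restrict: "set_add (M\<lparr>carrier := N\<rparr>) = set_add M"
  by (intro ext) (simp add: set_add_def')

end

text \<open>
  An epimorphism of structures transports the module axioms. This gives them for factor modules.
\<close>

lemma left_module_image:
  assumes "left_module R X" and g: "g \<in> lmod_hom R X H" and surj: "g ` carrier X = carrier H"
    and zero: "\<zero>\<^bsub>H\<^esub> = g \<zero>\<^bsub>X\<^esub>"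
  shows "left_module R H"
proof -
  interpret X: left_module R X by fact
  have add: "g x \<oplus>\<^bsub>H\<^esub> g y = g (x \<oplus>\<^bsub>X\<^esub> y)" if "x \<in> carrier X" "y \<in> carrier X" for x y
    using g that by (auto simp: lmod_hom_def)
  have smult: "r \<odot>\<^bsub>H\<^esub> g x = g (r \<odot>\<^bsub>X\<^esub> x)" if "r \<in> carrier R" "x \<in> carrier X" for r x
    using g that by (auto simp: lmod_hom_def)
  have "abelian_group H"
  proof (rule abelian_groupI)
    fix h assume "h \<in> carrier H"
    then obtain x where x: "x \<in> carrier X" "h = g x" using surj by auto
    show "\<exists>y\<in>carrier H. y \<oplus>\<^bsub>H\<^esub> h = \<zero>\<^bsub>H\<^esub>"
      using x by (intro bexI[of _ "g (\<ominus>\<^bsub>X\<^esub> x)"])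
        (auto simp: add zero X.M.l_neg simp flip: surj)
  qed (auto simp: add zero X.M.a_ac simp flip: surj)
  then show ?thesis
    using X.R.ring_axioms
    by (auto simp: left_module_def left_module_axioms_def add smult simp flip: surj)
      (auto simp: X.smult_l_distr X.smult_r_distr X.smult_assoc1 simp flip: add)
qed

text \<open>
  An epimorphism with kernel \<open>K\<close> relates the submodules of its codomain to the submodules that contain \<open>K\<close>,
  by images and preimages, and both operations preserve the property of adding up to everything. It
  is stated for an arbitrary epimorphism because it is applied to the projections onto \<open>X / K\<close> and
  also to the components of a homomorphism into a direct sum.
\<close>

lemma hollow_image_iff:
  assumes X: "left_module R X" and H: "left_module R H"
    and g: "g \<in> lmod_hom R X H" and surj: "g ` carrier X = carrier H"
    and K: "K = {x \<in> carrier X. g x = \<zero>\<^bsub>H\<^esub>}" and KS: "submodule K R X"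
  shows "hollow R H \<longleftrightarrow> modular_set_lattice.hollow_above {N. submodule N R X} (carrier X) (set_add X) K"
proof -
  interpret X: left_module R X by fact
  interpret H: left_module R H by fact
  have gc [simp]: "g x \<in> carrier H" if "x \<in> carrier X" for x
    using g that by (auto simp: lmod_hom_def)
  have add [simp]: "g (x \<oplus>\<^bsub>X\<^esub> y) = g x \<oplus>\<^bsub>H\<^esub> g y" if "x \<in> carrier X" "y \<in> carrier X" for x y
    using g that by (auto simp: lmod_hom_def)
  have smult [simp]: "g (r \<odot>\<^bsub>X\<^esub> x) = r \<odot>\<^bsub>H\<^esub> g x" if "r \<in> carrier R" "x \<in> carrier X" for r x
    using g that by (auto simp: lmod_hom_def)
  have zero [simp]: "g \<zero>\<^bsub>X\<^esub> = \<zero>\<^bsub>H\<^esub>"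
    using KS unfolding X.submodule_iff by (auto simp: K)
  have neg [simp]: "g (\<ominus>\<^bsub>X\<^esub> x) = \<ominus>\<^bsub>H\<^esub> g x" if "x \<in> carrier X" for x
    using that add[of "\<ominus>\<^bsub>X\<^esub> x" x] by (intro H.M.minus_equality[symmetric]) (simp_all add: X.M.l_neg)
  have diff: "x \<ominus>\<^bsub>X\<^esub> y \<in> K" if "x \<in> carrier X" "y \<in> carrier X" "g x = g y" for x y
    using that by (simp add: K a_minus_def H.M.r_neg)
  have cancel: "x = y \<oplus>\<^bsub>X\<^esub> (x \<ominus>\<^bsub>X\<^esub> y)" if "x \<in> carrier X" "y \<in> carrier X" for x y
    using that by (simp add: X.minus_add_cancel)
  have image: "submodule (g ` A) R H" if A: "submodule A R X" for A
  proof -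
    have *: "A \<subseteq> carrier X" "x \<in> A \<Longrightarrow> x \<in> carrier X" for x using A by (auto simp: X.submodule_iff)
    show ?thesis
      using A * unfolding X.submodule_iff H.submodule_iff
      by (auto simp flip: add smult neg zero)
  qed
  define pre where "pre = (\<lambda>N. {x \<in> carrier X. g x \<in> N})"
  have pre: "submodule (pre N) R X" "K \<subseteq> pre N" "g ` pre N = N" if N: "submodule N R H" for N
  proof -
    show "submodule (pre N) R X" "K \<subseteq> pre N"
      using N by (auto simp: X.submodule_iff H.submodule_iff K pre_def)
    have "N \<subseteq> g ` carrier X" using N surj by (simp add: H.submodule_iff)
    then show "g ` pre N = N" by (auto simp: pre_def)
  qed
  have full: "A = carrier X" if A: "submodule A R X" "K \<subseteq> A" "g ` A = carrier H" for A
  proof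
    show "A \<subseteq> carrier X" using A by (simp add: X.submodule_iff)
    show "carrier X \<subseteq> A"
    proof
      fix x assume x: "x \<in> carrier X"
      then have "g x \<in> g ` A" using A(3) by simp
      then obtain a where a: "a \<in> A" "g x = g a" by auto
      have "a \<in> carrier X" using a A by (auto simp: X.submodule_iff)
      then have "x = a \<oplus>\<^bsub>X\<^esub> (x \<ominus>\<^bsub>X\<^esub> a)" "x \<ominus>\<^bsub>X\<^esub> a \<in> A" using diff cancel x a A by auto
      then show "x \<in> A" using A a by (metis X.submodule_iff)
    qed
  qed
  have Kne: "K \<noteq> carrier X \<longleftrightarrow> carrier H \<noteq> {\<zero>\<^bsub>H\<^esub>}"
    using surj[symmetric] zero X.M.zero_closed by (auto simp: K image_iff simp del: zero)
  show ?thesis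
  proof
    assume h: "hollow R H"
    show "X.submodules.hollow_above K"
      unfolding X.submodules.hollow_above_def
    proof (intro conjI ballI impI, unfold mem_Collect_eq)
      show "submodule K R X" "K \<noteq> carrier X" using KS h Kne by (auto simp: hollow_def)
      fix A B assume A: "submodule A R X" "K \<subseteq> A" and B: "submodule B R X" "K \<subseteq> B"
        and AB: "A <+>\<^bsub>X\<^esub> B = carrier X"
      have "carrier H \<subseteq> g ` A <+>\<^bsub>H\<^esub> g ` B"
      proof
        fix h assume "h \<in> carrier H"
        then obtain x where "x \<in> A <+>\<^bsub>X\<^esub> B" "h = g x" using surj AB by auto
        then obtain a b where "a \<in> A" "b \<in> B" "h = g (a \<oplus>\<^bsub>X\<^esub> b)" by (auto simp: mem_set_add)
        moreover from this have "g (a \<oplus>\<^bsub>X\<^esub> b) = g a \<oplus>\<^bsub>H\<^esub> g b"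
          using X.submodule_subset[OF A(1)] X.submodule_subset[OF B(1)] by simp
        ultimately show "h \<in> g ` A <+>\<^bsub>H\<^esub> g ` B" by (auto simp: mem_set_add)
      qed
      then have "g ` A <+>\<^bsub>H\<^esub> g ` B = carrier H"
        using image[OF A(1)] image[OF B(1)] by (intro H.submodules.join_eq_topI) auto
      then have "g ` A = carrier H \<or> g ` B = carrier H"
        using h image[OF A(1)] image[OF B(1)] unfolding hollow_def small_submodule_def by blast
      then show "A = carrier X \<or> B = carrier X" using full A B by blast
    qed
  next
    assume h: "X.submodules.hollow_above K"
    show "hollow R H"
      unfolding hollow_def small_submodule_def
    proof (intro conjI allI impI)
      show "carrier H \<noteq> {\<zero>\<^bsub>H\<^esub>}" using h Kne by (simp add: X.submodules.hollow_above_def)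
      fix N L assume N: "submodule N R H" "N \<noteq> carrier H" and L: "submodule L R H"
        and NL: "N <+>\<^bsub>H\<^esub> L = carrier H"
      have "x \<in> pre N <+>\<^bsub>X\<^esub> pre L" if x: "x \<in> carrier X" for x
      proof -
        have "g x \<in> N <+>\<^bsub>H\<^esub> L" using x NL by simp
        then obtain n l where nl: "n \<in> N" "l \<in> L" "g x = n \<oplus>\<^bsub>H\<^esub> l" by (auto simp: mem_set_add)
        obtain a where a: "a \<in> pre N" "g a = n" using pre(3)[OF N(1)] nl by (metis image_iff)
        have [simp]: "a \<in> carrier X" "n \<in> carrier H" "l \<in> carrier H" 
          using a nl H.submodule_subset[OF N(1)] H.submodule_subset[OF L] by (auto simp: pre_def)
        have "g (x \<ominus>\<^bsub>X\<^esub> a) = l"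
          using x a(2) nl(3) H.minus_add_cancel(3)[of l n] by (simp add: a_minus_def)
        then have "x \<ominus>\<^bsub>X\<^esub> a \<in> pre L" using x nl by (simp add: pre_def)
        then show ?thesis using a cancel[of x a] x by (auto simp: mem_set_add)
      qed
      then have "pre N <+>\<^bsub>X\<^esub> pre L = carrier X"
        using X.submodules.join_eq_topI[of "pre N" "pre L"] pre N L by blast
      then have "pre N = carrier X \<or> pre L = carrier X"
        using h pre(1,2)[OF N(1)] pre(1,2)[OF L] by (simp add: X.submodules.hollow_above_def)
      then show "L = carrier H"
      proof
        assume "pre N = carrier X"
        then show ?thesis using pre(3)[OF N(1)] N(2) surj by simp
      next
        assume "pre L = carrier X"
        then show ?thesis using pre(3)[OF L] surj by simp
      qed
    qed
  qed
qed

context left_module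
begin

lemma submodule_abelian_subgroup: "submodule K R M \<Longrightarrow> abelian_subgroup K M"
  by (intro abelian_subgroupI3 additive_subgroupI M.abelian_group_axioms) (simp add: submodule_def)

lemma coset_eq_iff:
  assumes K: "submodule K R M" and x: "x \<in> carrier M" and y: "y \<in> carrier M"
  shows "K +>\<^bsub>M\<^esub> x = K +>\<^bsub>M\<^esub> y \<longleftrightarrow> x \<ominus>\<^bsub>M\<^esub> y \<in> K"
proof -
  interpret K: abelian_subgroup K M using K by (rule submodule_abelian_subgroup)
  have KM: "K \<subseteq> carrier M" "subgroup K (add_monoid M)" using K by (auto simp: submodule_iff submodule_def)
  show ?thesis
    unfolding a_minus_def
    using M.a_coset_add_inv1[OF _ x y KM(1)] M.a_coset_add_inv2[OF _ x y KM(1)] x y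
      M.a_coset_join1[OF _ _ KM(2), of "x \<oplus>\<^bsub>M\<^esub> \<ominus>\<^bsub>M\<^esub> y"]
      M.a_coset_join2[OF _ KM(2), of "x \<oplus>\<^bsub>M\<^esub> \<ominus>\<^bsub>M\<^esub> y"]
    by (metis M.a_closed M.a_inv_closed)
qed

lemma coset_eq_self_iff:
  "\<lbrakk>submodule K R M; x \<in> carrier M\<rbrakk> \<Longrightarrow> K +>\<^bsub>M\<^esub> x = K \<longleftrightarrow> x \<in> K"
  using coset_eq_iff[of K x "\<zero>\<^bsub>M\<^esub>"] minus_add_cancel(1)[of x "\<zero>\<^bsub>M\<^esub>"]
  by (simp add: submodule_iff M.minus_closed)

lemma quot_module_projection:
  assumes K: "submodule K R M"
  shows "(\<lambda>x. K +>\<^bsub>M\<^esub> x) \<in> lmod_hom R M (quot_module M K)"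
    and "(\<lambda>x. K +>\<^bsub>M\<^esub> x) ` carrier M = carrier (quot_module M K)"
proof -
  interpret K: abelian_subgroup K M using K by (rule submodule_abelian_subgroup)
  have KM: "K \<subseteq> carrier M" using K by (simp add: submodule_iff)
  show "(\<lambda>x. K +>\<^bsub>M\<^esub> x) ` carrier M = carrier (quot_module M K)"
    by (auto simp: quot_module_def A_RCOSETS_def')
  have "K +>\<^bsub>M\<^esub> (r \<odot>\<^bsub>M\<^esub> x) = (\<Union>y\<in>K +>\<^bsub>M\<^esub> x. K +>\<^bsub>M\<^esub> (r \<odot>\<^bsub>M\<^esub> y))"
    if r: "r \<in> carrier R" and x: "x \<in> carrier M" for r x
  proof -
    have "K +>\<^bsub>M\<^esub> (r \<odot>\<^bsub>M\<^esub> y) = K +>\<^bsub>M\<^esub> (r \<odot>\<^bsub>M\<^esub> x)" if yx: "y \<in> K +>\<^bsub>M\<^esub> x" for y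
    proof -
      obtain k where k: "k \<in> K" "y = k \<oplus>\<^bsub>M\<^esub> x" using yx by (auto simp: a_r_coset_def')
      have kM: "k \<in> carrier M" using k KM by auto
      have "r \<odot>\<^bsub>M\<^esub> y \<ominus>\<^bsub>M\<^esub> r \<odot>\<^bsub>M\<^esub> x = r \<odot>\<^bsub>M\<^esub> k"
        using r x kM by (simp add: k smult_r_distr M.a_comm[of "r \<odot>\<^bsub>M\<^esub> k"] minus_add_cancel)
      then have "r \<odot>\<^bsub>M\<^esub> y \<ominus>\<^bsub>M\<^esub> r \<odot>\<^bsub>M\<^esub> x \<in> K" using K k r by (simp add: submodule_iff)
      then show ?thesis using coset_eq_iff[OF K] r x k kM by simp
    qed
    then show ?thesis using K.a_rcos_self[OF x] by blast
  qed
  then show "(\<lambda>x. K +>\<^bsub>M\<^esub> x) \<in> lmod_hom R M (quot_module M K)"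
    using K.a_rcos_sum KM by (auto simp: lmod_hom_def quot_module_def M.a_rcosetsI)
qed

lemma left_module_quot_module:
  assumes K: "submodule K R M"
  shows "left_module R (quot_module M K)"
proof (rule left_module_image[OF left_module_axioms quot_module_projection[OF K]])
  show "\<zero>\<^bsub>quot_module M K\<^esub> = K +>\<^bsub>M\<^esub> \<zero>\<^bsub>M\<^esub>"
    using K by (simp add: quot_module_def submodule_iff)
qed

lemma hollow_quot_module_iff:
  assumes K: "submodule K R M"
  shows "hollow R (quot_module M K) \<longleftrightarrow> submodules.hollow_above K"
proof (rule hollow_image_iff[OF left_module_axioms left_module_quot_module[OF K]
        quot_module_projection[OF K] _ K])
  show "K = {x \<in> carrier M. K +>\<^bsub>M\<^esub> x = \<zero>\<^bsub>quot_module M K\<^esub>}"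
    using coset_eq_self_iff[OF K] submodule_subset[OF K] by (auto simp: quot_module_def)
qed

text \<open>
  The analogue of the Chinese remainder theorem: a solution \<open>y\<close> of the first \<open>n\<close> conditions is corrected by
  an element of their common kernel, which is comaximal with \<open>K n\<close>.
\<close>

lemma coindependent_simultaneous:
  fixes n :: nat
  assumes K: "\<And>i. i < n \<Longrightarrow> submodule (K i) R M" and co: "submodules.coindependent {..<n} K"
    and x: "\<And>i. i < n \<Longrightarrow> x i \<in> carrier M"
  shows "\<exists>y\<in>carrier M. \<forall>i<n. K i +>\<^bsub>M\<^esub> y = K i +>\<^bsub>M\<^esub> x i"
  using assms
proof (induction n)
  case 0
  then show ?case by auto
next
  case (Suc n)
  have "submodules.coindependent {..<n} K"
    using Suc.prems by (intro submodules.coindependent_subset[of "{..<Suc n}" "{..<n}"]) auto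
  then obtain y where y: "y \<in> carrier M" "\<forall>i<n. K i +>\<^bsub>M\<^esub> y = K i +>\<^bsub>M\<^esub> x i"
    using Suc by auto
  have "{..<Suc n} - {n} = {..<n}" by auto
  then have "K n <+>\<^bsub>M\<^esub> submodules.meet {..<n} K = carrier M"
    using Suc.prems(2) by (metis lessThan_iff lessI submodules.coindependent_def)
  then have "x n \<ominus>\<^bsub>M\<^esub> y \<in> K n <+>\<^bsub>M\<^esub> submodules.meet {..<n} K"
    using y Suc.prems(3)[of n] by simp
  then obtain k d where kd: "k \<in> K n" "d \<in> submodules.meet {..<n} K" "x n \<ominus>\<^bsub>M\<^esub> y = k \<oplus>\<^bsub>M\<^esub> d"
    by (auto simp: mem_set_add)
  have mem [simp]: "k \<in> carrier M" "d \<in> carrier M" "x n \<in> carrier M" "y \<in> carrier M"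
    using kd y Suc.prems submodule_subset[OF Suc.prems(1)[of n]] by (auto simp: submodules.meet_def)
  have "K i +>\<^bsub>M\<^esub> (y \<oplus>\<^bsub>M\<^esub> d) = K i +>\<^bsub>M\<^esub> x i" if "i < Suc n" for i
  proof (cases "i = n")
    case True
    have "x n = (k \<oplus>\<^bsub>M\<^esub> d) \<oplus>\<^bsub>M\<^esub> y"
      unfolding kd(3)[symmetric] by (simp add: minus_add_cancel)
    then have "x n \<ominus>\<^bsub>M\<^esub> (y \<oplus>\<^bsub>M\<^esub> d) = k"
      using minus_add_cancel(3)[of k "y \<oplus>\<^bsub>M\<^esub> d"] by (simp add: M.a_ac)
    then show ?thesis using coset_eq_iff[of "K n" "x n" "y \<oplus>\<^bsub>M\<^esub> d"] kd Suc.prems True by simp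
  next
    case False
    then have "d \<in> K i" using kd that by (auto simp: submodules.meet_def)
    then have "(y \<oplus>\<^bsub>M\<^esub> d) \<ominus>\<^bsub>M\<^esub> y \<in> K i"
      by (simp add: minus_add_cancel)
    then show ?thesis using coset_eq_iff[of "K i" "y \<oplus>\<^bsub>M\<^esub> d" y] False that y Suc.prems by simp
  qed
  then show ?case by (intro bexI[of _ "y \<oplus>\<^bsub>M\<^esub> d"]) auto
qed

text \<open>
  The decomposition consists of the kernels \<open>L i\<close> of the components of the given epimorphism \<open>f\<close>. These may
  differ from the submodules \<open>K i\<close> in the definition, but \<open>f\<close> identifies the factor modules.
  Surjectivity of \<open>f\<close> gives coindependence: for given \<open>x\<close> there is an element whose \<open>i\<close>-th component is that
  of \<open>x\<close> and whose other components vanish.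
\<close>

lemma finite_hollow_dim_imp_decomposition:
  assumes "finite_hollow_dim R M"
  shows "\<exists>n L. submodules.finite_hollow_decomposition n L"
proof -
  obtain n K f where K: "\<And>i. i < n \<Longrightarrow> submodule (K i) R M \<and> hollow R (quot_module M (K i))"
    and f: "f \<in> lmod_hom R M (direct_sum n (\<lambda>i. quot_module M (K i)))"
    and surj: "f ` carrier M = carrier (direct_sum n (\<lambda>i. quot_module M (K i)))"
    and small: "small_submodule R M (a_kernel M (direct_sum n (\<lambda>i. quot_module M (K i))) f)"
    using assms unfolding finite_hollow_dim_def by blast
  let ?Q = "\<lambda>i. quot_module M (K i)"
  have Q: "left_module R (?Q i)" if "i < n" for i using K that left_module_quot_module by blast
  define L where "L = (\<lambda>i. {x \<in> carrier M. f x i = \<zero>\<^bsub>?Q i\<^esub>})"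
  have proj: "(\<lambda>x. f x i) \<in> lmod_hom R M (?Q i)" if "i < n" for i
    using f that by (auto simp: lmod_hom_def direct_sum_def PiE_iff)
  have lift: "\<exists>y\<in>carrier M. \<forall>i<n. f y i = q i" if q: "\<And>i. i < n \<Longrightarrow> q i \<in> carrier (?Q i)" for q
  proof -
    have "restrict q {..<n} \<in> f ` carrier M" unfolding surj using q by (auto simp: direct_sum_def PiE_iff)
    then obtain y where "y \<in> carrier M" "restrict q {..<n} = f y" by auto
    then show ?thesis by (metis lessThan_iff restrict_apply')
  qed
  have fc: "f x i \<in> carrier (?Q i)" if "i < n" "x \<in> carrier M" for i x
    using proj[OF that(1)] that by (auto simp: lmod_hom_def)
  have psurj: "(\<lambda>x. f x i) ` carrier M = carrier (?Q i)" if i: "i < n" for i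
  proof
    show "(\<lambda>x. f x i) ` carrier M \<subseteq> carrier (?Q i)" using fc i by auto
    show "carrier (?Q i) \<subseteq> (\<lambda>x. f x i) ` carrier M"
    proof
      fix q assume q: "q \<in> carrier (?Q i)"
      have "\<And>j. j < n \<Longrightarrow> ((\<lambda>j. \<zero>\<^bsub>?Q j\<^esub>)(i := q)) j \<in> carrier (?Q j)"
        using q Q abelian_group.axioms(1) abelian_monoid.zero_closed left_module.axioms(2) by fastforce
      from lift[OF this] show "q \<in> (\<lambda>x. f x i) ` carrier M" using i by fastforce
    qed
  qed
  have hom: "f (x \<oplus>\<^bsub>M\<^esub> y) i = f x i \<oplus>\<^bsub>?Q i\<^esub> f y i" "r \<in> carrier R \<Longrightarrow> f (r \<odot>\<^bsub>M\<^esub> x) i = r \<odot>\<^bsub>?Q i\<^esub> f x i"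
    if "i < n" "x \<in> carrier M" "y \<in> carrier M" for i x y r
    using proj[OF that(1)] that by (auto simp: lmod_hom_def)
  have f0: "f \<zero>\<^bsub>M\<^esub> i = \<zero>\<^bsub>?Q i\<^esub>" if i: "i < n" for i
  proof -
    interpret Q: left_module R "?Q i" using Q i by blast
    show ?thesis using hom(1)[OF i, of "\<zero>\<^bsub>M\<^esub>" "\<zero>\<^bsub>M\<^esub>"] fc[OF i, of "\<zero>\<^bsub>M\<^esub>"] Q.M.add.r_cancel_one by simp
  qed
  have fneg: "f (\<ominus>\<^bsub>M\<^esub> x) i = \<ominus>\<^bsub>?Q i\<^esub> f x i" if i: "i < n" and x: "x \<in> carrier M" for i x
  proof -
    interpret Q: left_module R "?Q i" using Q i by blast
    show ?thesis
      using hom(1)[OF i, of "\<ominus>\<^bsub>M\<^esub> x" x] fc[OF i] f0[OF i] x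
      by (intro Q.M.minus_equality[symmetric]) (simp_all add: M.l_neg)
  qed
  have LS: "submodule (L i) R M" if i: "i < n" for i
  proof -
    interpret Q: left_module R "?Q i" using Q i by blast
    show ?thesis
      unfolding submodule_iff L_def using hom[OF i] f0[OF i] fneg[OF i]
      by (auto simp: Q.smult_zero)
  qed
  have "submodules.hollow_above (L i)" if i: "i < n" for i
    using hollow_image_iff[OF left_module_axioms Q[OF i] proj[OF i] psurj[OF i] _ LS[OF i]] K i
    by (simp add: L_def)
  moreover have "submodules.coindependent {..<n} L"
    unfolding submodules.coindependent_def
  proof (intro ballI submodules.join_eq_topI, unfold mem_Collect_eq)
    fix i assume "i \<in> {..<n}"
    then have i: "i < n" by simp
    interpret Q: left_module R "?Q i" using Q i by blast
    show "submodule (L i) R M" using LS i by simp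
    show "submodule (submodules.meet ({..<n} - {i}) L) R M"
      using LS by (intro submodule_meet) auto
    show "carrier M \<subseteq> L i <+>\<^bsub>M\<^esub> submodules.meet ({..<n} - {i}) L"
    proof
      fix x assume x: "x \<in> carrier M"
      have "\<And>j. j < n \<Longrightarrow> ((\<lambda>j. \<zero>\<^bsub>?Q j\<^esub>)(i := f x i)) j \<in> carrier (?Q j)"
        using fc[OF i x] Q abelian_group.axioms(1) abelian_monoid.zero_closed left_module.axioms(2)
        by fastforce
      from lift[OF this] obtain y where y: "y \<in> carrier M" "\<forall>j<n. f y j = ((\<lambda>j. \<zero>\<^bsub>?Q j\<^esub>)(i := f x i)) j"
        by blast
      have "y \<in> submodules.meet ({..<n} - {i}) L"
        using y by (auto simp: submodules.meet_def L_def)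
      moreover have "x \<ominus>\<^bsub>M\<^esub> y \<in> L i"
        using x y i hom[OF i] fneg[OF i] fc[OF i] by (simp add: L_def a_minus_def Q.M.r_neg)
      moreover have "x = (x \<ominus>\<^bsub>M\<^esub> y) \<oplus>\<^bsub>M\<^esub> y"
        using x y by (simp add: minus_add_cancel)
      ultimately show "x \<in> L i <+>\<^bsub>M\<^esub> submodules.meet ({..<n} - {i}) L"
        by (auto simp: mem_set_add)
    qed
  qed
  moreover have "a_kernel M (direct_sum n ?Q) f = submodules.meet {..<n} L"
  proof -
    have "f x = \<zero>\<^bsub>direct_sum n ?Q\<^esub> \<longleftrightarrow> (\<forall>i<n. f x i = \<zero>\<^bsub>?Q i\<^esub>)" if "x \<in> carrier M" for x
    proof -
      have "f x \<in> carrier (direct_sum n ?Q)" using surj that by auto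
      then have "f x \<in> extensional {..<n}" by (auto simp: direct_sum_def PiE_iff)
      then show ?thesis
        by (auto simp: direct_sum_def fun_eq_iff extensional_def)
    qed
    then show ?thesis by (auto simp: a_kernel_def' submodules.meet_def L_def)
  qed
  ultimately have "submodules.finite_hollow_decomposition n L"
    using small by (simp add: submodules.finite_hollow_decomposition_def small_submodule_iff)
  then show ?thesis by blast
qed

lemma decomposition_imp_finite_hollow_dim:
  assumes L: "submodules.finite_hollow_decomposition n L"
  shows "finite_hollow_dim R M"
proof -
  let ?Q = "\<lambda>i. quot_module M (L i)"
  have LS: "submodule (L i) R M" if "i < n" for i
    using L that by (simp add: submodules.finite_hollow_decomposition_def submodules.hollow_above_def)
  have hollow: "hollow R (?Q i)" if "i < n" for i
    using L that hollow_quot_module_iff[OF LS[OF that]]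
    by (simp add: submodules.finite_hollow_decomposition_def)
  define f where "f = (\<lambda>x. \<lambda>i\<in>{..<n}. L i +>\<^bsub>M\<^esub> x)"
  have hom: "f \<in> lmod_hom R M (direct_sum n ?Q)"
    using quot_module_projection(1)[OF LS]
    by (auto simp: lmod_hom_def f_def direct_sum_def fun_eq_iff restrict_def Pi_iff)
  moreover have "f ` carrier M = carrier (direct_sum n ?Q)"
  proof
    show "f ` carrier M \<subseteq> carrier (direct_sum n ?Q)" using hom by (auto simp: lmod_hom_def)
    show "carrier (direct_sum n ?Q) \<subseteq> f ` carrier M"
    proof
      fix q assume q: "q \<in> carrier (direct_sum n ?Q)"
      have "\<exists>x\<in>carrier M. q i = L i +>\<^bsub>M\<^esub> x" if "i < n" for i
      proof -
        have "q i \<in> (\<lambda>x. L i +>\<^bsub>M\<^esub> x) ` carrier M"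
          unfolding quot_module_projection(2)[OF LS[OF that]]
          using q that by (auto simp: direct_sum_def PiE_iff)
        then show ?thesis by blast
      qed
      then obtain x where x: "\<And>i. i < n \<Longrightarrow> x i \<in> carrier M \<and> q i = L i +>\<^bsub>M\<^esub> x i" by metis
      then obtain y where y: "y \<in> carrier M" "\<forall>i<n. L i +>\<^bsub>M\<^esub> y = L i +>\<^bsub>M\<^esub> x i"
        using coindependent_simultaneous[of n L x] LS L
        by (auto simp: submodules.finite_hollow_decomposition_def)
      have "q \<in> extensional {..<n}" using q by (auto simp: direct_sum_def PiE_iff)
      then have "q = f y" using x y by (auto simp: f_def fun_eq_iff extensional_def)
      then show "q \<in> f ` carrier M" using y by simp
    qed
  qed
  moreover have "a_kernel M (direct_sum n ?Q) f = submodules.meet {..<n} L"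
    using coset_eq_self_iff[OF LS]
    by (auto simp: a_kernel_def' submodules.meet_def f_def direct_sum_def fun_eq_iff
        restrict_def quot_module_def)
  then have "small_submodule R M (a_kernel M (direct_sum n ?Q) f)"
    using L LS submodule_meet[of "{..<n}" L]
    by (simp add: small_submodule_iff submodules.finite_hollow_decomposition_def)
  ultimately show ?thesis
    unfolding finite_hollow_dim_def using LS hollow by blast
qed

lemma finite_hollow_dim_iff:
  "finite_hollow_dim R M \<longleftrightarrow> (\<forall>K. \<not> submodules.coindependent_sequence K)"
proof
  assume "finite_hollow_dim R M"
  then obtain n L where "submodules.finite_hollow_decomposition n L"
    using finite_hollow_dim_imp_decomposition by blast
  then show "\<forall>K. \<not> submodules.coindependent_sequence K"
    using submodules.no_coindependent_sequence by simp
next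
  assume "\<forall>K. \<not> submodules.coindependent_sequence K"
  then have "\<exists>n L. submodules.finite_hollow_decomposition n L"
    by (intro submodules.finite_hollow_decomposition_exists) simp
  then show "finite_hollow_dim R M" using decomposition_imp_finite_hollow_dim by blast
qed

end


section \<open>Small submodules under AB5*\<close>

context left_module
begin

definition generated :: "'m set \<Rightarrow> 'm set"
  where "generated Y = \<Inter>{N. submodule N R M \<and> Y \<subseteq> N}"

lemma submodule_generated: "Y \<subseteq> carrier M \<Longrightarrow> submodule (generated Y) R M"
  unfolding generated_def using submodule_carrier by (intro submodule_Inter) auto

lemma generated_superset: "Y \<subseteq> generated Y"
  by (auto simp: generated_def)

lemma generated_least: "\<lbrakk>submodule N R M; Y \<subseteq> N\<rbrakk> \<Longrightarrow> generated Y \<subseteq> N"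
  by (auto simp: generated_def)

lemma small_submodule_zero: "small_submodule R M {\<zero>\<^bsub>M\<^esub>}"
proof -
  have "submodule {\<zero>\<^bsub>M\<^esub>} R M" by (auto simp: submodule_iff smult_zero)
  moreover have "{\<zero>\<^bsub>M\<^esub>} <+>\<^bsub>M\<^esub> K = K" if "submodule K R M" for K
    using submodule_subset[OF that] by (force simp: set_add_def')
  ultimately show ?thesis by (auto simp: small_submodule_def)
qed

text \<open>
  A finite sum of small submodules is again small.
\<close>

lemma Rad_in_small_submodule:
  assumes "y \<in> Rad R M"
  shows "\<exists>T. small_submodule R M T \<and> y \<in> T"
proof -
  obtain x S where S: "finite S" "\<And>N. N \<in> S \<Longrightarrow> small_submodule R M N \<and> x N \<in> N"
    and y: "y = finsum M x S"
    using assms by (auto simp: Rad_def)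
  have "\<exists>T. small_submodule R M T \<and> finsum M x S \<in> T"
    using S
  proof (induction S rule: finite_induct)
    case empty
    then show ?case using small_submodule_zero by auto
  next
    case (insert N S)
    then obtain T where T: "small_submodule R M T" "finsum M x S \<in> T" by auto
    have N: "small_submodule R M N" "x N \<in> N" using insert.prems by auto
    have "x \<in> insert N S \<rightarrow> carrier M"
      using insert.prems submodule_subset by (fastforce simp: small_submodule_def)
    then have "finsum M x (insert N S) = x N \<oplus>\<^bsub>M\<^esub> finsum M x S"
      using insert.hyps by (intro M.finsum_insert) auto
    then have "finsum M x (insert N S) \<in> N <+>\<^bsub>M\<^esub> T" using N T by (auto simp: mem_set_add)
    then show ?case using small_submodule_set_add[OF N(1) T(1)] by blast
  qed
  then show ?thesis by (simp add: y)
qed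

lemma AB5_starD:
  assumes "AB5_star R M" "submodule N R M" "F \<noteq> {}" "\<And>A. A \<in> F \<Longrightarrow> submodule A R M"
    and "\<And>A B. A \<in> F \<Longrightarrow> B \<in> F \<Longrightarrow> \<exists>C\<in>F. C \<subseteq> A \<inter> B"
  shows "N <+>\<^bsub>M\<^esub> \<Inter>F = (\<Inter>A\<in>F. N <+>\<^bsub>M\<^esub> A)"
proof -
  have "inverse_system R M F" using assms unfolding inverse_system_def by blast
  then have "N <+>\<^bsub>M\<^esub> (\<Inter>A\<in>F. A) = (\<Inter>A\<in>F. N <+>\<^bsub>M\<^esub> A)"
    using assms unfolding AB5_star_def by blast
  then show ?thesis by simp
qed

lemma AB5_star_decreasing:
  fixes U :: "nat \<Rightarrow> 'm set"
  assumes "AB5_star R M" "submodule N R M" "\<And>n. submodule (U n) R M" "antimono U"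
  shows "N <+>\<^bsub>M\<^esub> (\<Inter>n. U n) = (\<Inter>n. N <+>\<^bsub>M\<^esub> U n)"
proof -
  have "\<exists>C\<in>range U. C \<subseteq> A \<inter> B" if "A \<in> range U" "B \<in> range U" for A B
  proof -
    obtain m n where "A = U m" "B = U n" using \<open>A \<in> range U\<close> \<open>B \<in> range U\<close> by blast
    then have "U (max m n) \<subseteq> A \<inter> B"
      using antimonoD[OF assms(4), of m "max m n"] antimonoD[OF assms(4), of n "max m n"] by auto
    then show ?thesis by blast
  qed
  then have "N <+>\<^bsub>M\<^esub> \<Inter>(range U) = (\<Inter>A\<in>range U. N <+>\<^bsub>M\<^esub> A)"
    using assms(3) by (intro AB5_starD assms(1,2)) auto
  then show ?thesis by simp
qed

text \<open>
  By \<open>AB5\<^sup>*\<close> the intersection of a chain of submodules that supplement \<open>L\<close> in \<open>N\<close> still supplements it, so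
  Zorn's lemma applies downwards.
\<close>

lemma minimal_supplement:
  assumes AB5: "AB5_star R M" and N: "submodule N R M" and L: "submodule L R M" and LN: "L \<subseteq> N"
  obtains C where "submodule C R M" "C \<subseteq> N" "L <+>\<^bsub>M\<^esub> C = N"
    "\<And>A. \<lbrakk>submodule A R M; A \<subseteq> C; L <+>\<^bsub>M\<^esub> A = N\<rbrakk> \<Longrightarrow> A = C"
proof -
  define \<A> where "\<A> = {A. submodule A R M \<and> A \<subseteq> N \<and> L <+>\<^bsub>M\<^esub> A = N}"
  have LNN: "L <+>\<^bsub>M\<^esub> N = N"
    using submodules.join_least[of L N N] submodules.join_upper2[of L N] N L LN by auto
  have "\<exists>C\<in>\<A>. \<forall>A\<in>\<A>. A \<subseteq> C \<longrightarrow> A = C"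
  proof (rule predicate_Zorn)
    show "partial_order_on \<A> (relation_of (\<lambda>A B. B \<subseteq> A) \<A>)"
      by (intro partial_order_on_relation_ofI) auto
    fix \<C> assume "\<C> \<in> Chains (relation_of (\<lambda>A B. B \<subseteq> A) \<A>)"
    then have \<C>: "\<C> \<subseteq> \<A>" and total: "\<And>A B. A \<in> \<C> \<Longrightarrow> B \<in> \<C> \<Longrightarrow> A \<subseteq> B \<or> B \<subseteq> A"
      by (auto simp: Chains_def relation_of_def)
    show "\<exists>D\<in>\<A>. \<forall>A\<in>\<C>. D \<subseteq> A"
    proof (cases "\<C> = {}")
      case True
      then show ?thesis using N LNN by (auto simp: \<A>_def)
    next
      case False
      have "\<exists>D\<in>\<C>. D \<subseteq> A \<inter> B" if "A \<in> \<C>" "B \<in> \<C>" for A B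
        using total[OF that] that by blast
      then have "L <+>\<^bsub>M\<^esub> \<Inter>\<C> = (\<Inter>A\<in>\<C>. L <+>\<^bsub>M\<^esub> A)"
        using \<C> False by (intro AB5_starD AB5 L) (auto simp: \<A>_def)
      also have "\<dots> = N" using \<C> False by (auto simp: \<A>_def)
      finally have "\<Inter>\<C> \<in> \<A>"
        using \<C> False submodule_Inter[of \<C>] by (auto simp: \<A>_def)
      then show ?thesis by blast
    qed
  qed
  then obtain C where C: "C \<in> \<A>" "\<And>A. A \<in> \<A> \<Longrightarrow> A \<subseteq> C \<Longrightarrow> A = C" by blast
  show ?thesis
  proof (rule that)
    show "submodule C R M" "C \<subseteq> N" "L <+>\<^bsub>M\<^esub> C = N" using C(1) by (simp_all add: \<A>_def)
    fix A assume A: "submodule A R M" "A \<subseteq> C" "L <+>\<^bsub>M\<^esub> A = N"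
    moreover have "A \<subseteq> N" using A(2) C(1) by (auto simp: \<A>_def)
    ultimately show "A = C" by (intro C(2)) (simp_all add: \<A>_def)
  qed
qed

text \<open>
  If \<open>Y\<close> together with \<open>C \<inter> L\<close> is everything, then by the modular law \<open>C\<close> is the sum of \<open>C \<inter> L\<close> and
  \<open>Y \<inter> C\<close>. So \<open>Y \<inter> C\<close> already supplements \<open>L\<close>, and minimality gives \<open>C \<subseteq> Y\<close>.
\<close>

lemma minimal_supplement_small:
  assumes L: "submodule L R M" and C: "submodule C R M" and LC: "L <+>\<^bsub>M\<^esub> C = N"
    and minimal: "\<And>A. \<lbrakk>submodule A R M; A \<subseteq> C; L <+>\<^bsub>M\<^esub> A = N\<rbrakk> \<Longrightarrow> A = C"
  shows "small_submodule R M (C \<inter> L)"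
  unfolding small_submodule_def
proof (intro conjI allI impI)
  show CL: "submodule (C \<inter> L) R M" by (rule submodule_Int[OF C L])
  fix Y assume Y: "submodule Y R M" and top: "(C \<inter> L) <+>\<^bsub>M\<^esub> Y = carrier M"
  have YC: "submodule (Y \<inter> C) R M" by (rule submodule_Int[OF Y C])
  have N: "submodule N R M" using submodule_set_add[OF L C] by (simp add: LC)
  have S: "submodule (L <+>\<^bsub>M\<^esub> (Y \<inter> C)) R M" by (rule submodule_set_add[OF L YC])
  have "C \<subseteq> ((C \<inter> L) <+>\<^bsub>M\<^esub> Y) \<inter> C" using top C by (auto simp: submodule_iff)
  also have "\<dots> \<subseteq> (C \<inter> L) <+>\<^bsub>M\<^esub> (Y \<inter> C)"
    using CL Y C by (intro submodules.modular) auto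
  also have "\<dots> \<subseteq> L <+>\<^bsub>M\<^esub> (Y \<inter> C)"
    using CL L YC by (intro submodules.join_mono) auto
  finally have "L <+>\<^bsub>M\<^esub> C \<subseteq> L <+>\<^bsub>M\<^esub> (Y \<inter> C)"
    using L C S set_add_upper1[OF L YC] by (intro submodules.join_least) auto
  moreover have "L <+>\<^bsub>M\<^esub> (Y \<inter> C) \<subseteq> L <+>\<^bsub>M\<^esub> C"
    using L C YC by (intro submodules.join_mono) auto
  ultimately have "Y \<inter> C = C" using minimal[OF YC] LC by auto
  then have "(C \<inter> L) <+>\<^bsub>M\<^esub> Y \<subseteq> Y" using CL Y by (intro submodules.join_least) auto
  then show "Y = carrier M" using top Y by (auto simp: submodule_iff)
qed

text \<open>
  If \<open>U 0 + Y\<close> is everything, then so is \<open>U n + Y\<close> for every \<open>n\<close>, since the small summands \<open>T n\<close> can be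
  dropped one at a time. By \<open>AB5\<^sup>*\<close> the intersection of all \<open>U n\<close> has the same property, and it is small
  because it lies in \<open>D\<close>.
\<close>

lemma small_submodule_by_tails:
  fixes U T :: "nat \<Rightarrow> 'm set"
  assumes AB5: "AB5_star R M" and U: "\<And>n. submodule (U n) R M" "antimono U"
    and T: "\<And>n. small_submodule R M (T n)" and step: "\<And>n. U n \<subseteq> T n <+>\<^bsub>M\<^esub> U (Suc n)"
    and D: "small_submodule R M D" "(\<Inter>n. U n) \<subseteq> D"
  shows "small_submodule R M (U 0)"
  unfolding small_submodule_def
proof (intro conjI allI impI)
  show "submodule (U 0) R M" by (rule U)
  fix Y assume Y: "submodule Y R M" and top: "U 0 <+>\<^bsub>M\<^esub> Y = carrier M"
  have TS: "submodule (T n) R M" for n using T by (simp add: small_submodule_def)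
  have "U n <+>\<^bsub>M\<^esub> Y = carrier M" for n
  proof (induction n)
    case 0
    then show ?case by (rule top)
  next
    case (Suc n)
    have UY: "submodule (U (Suc n) <+>\<^bsub>M\<^esub> Y) R M" by (rule submodule_set_add[OF U(1) Y])
    have "U n <+>\<^bsub>M\<^esub> Y \<subseteq> (T n <+>\<^bsub>M\<^esub> U (Suc n)) <+>\<^bsub>M\<^esub> Y"
      using U TS Y step submodule_set_add by (intro submodules.join_mono) auto
    also have "\<dots> = T n <+>\<^bsub>M\<^esub> (U (Suc n) <+>\<^bsub>M\<^esub> Y)" by (rule set_add_assoc[OF TS U(1) Y])
    finally have "T n <+>\<^bsub>M\<^esub> (U (Suc n) <+>\<^bsub>M\<^esub> Y) = carrier M"
      using Suc TS UY by (intro submodules.join_eq_topI) auto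
    then show ?case using T UY by (simp add: small_submodule_def)
  qed
  then have "Y <+>\<^bsub>M\<^esub> U n = carrier M" for n
    using submodules.join_commute[of Y "U n"] Y U(1) by simp
  then have "Y <+>\<^bsub>M\<^esub> (\<Inter>n. U n) = carrier M"
    using AB5_star_decreasing[of Y U, OF AB5 Y U] by simp
  moreover have I: "submodule (\<Inter>n. U n) R M" using U by (intro submodule_Inter) auto
  ultimately have "(\<Inter>n. U n) <+>\<^bsub>M\<^esub> Y = carrier M"
    using submodules.join_commute[of Y "\<Inter>n. U n"] Y by simp
  then show "Y = carrier M"
    using small_submodule_mono[OF D(1) I D(2)] Y by (simp add: small_submodule_def)
qed

text \<open>
  Coindependence controls finite intersections only. The finite partial intersections over the indices
  other than \<open>i\<close> form a descending sequence, each comaximal with \<open>K i\<close> in \<open>N\<close>, and \<open>AB5\<^sup>*\<close> carries this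
  over to their intersection.
\<close>

lemma coindependent_sequence_complete:
  assumes AB5: "AB5_star R M" and N: "submodule N R M"
    and K: "modular_set_lattice.coindependent_sequence {A. submodule A R (M\<lparr>carrier := N\<rparr>)} N (set_add M) K"
  shows "K i <+>\<^bsub>M\<^esub> (N \<inter> (\<Inter>j\<in>-{i}. K j)) = N"
proof -
  interpret N: left_module R "M\<lparr>carrier := N\<rparr>" using N by (rule left_module_submodule)
  have K: "N.submodules.coindependent_sequence K"
    using K by (simp add: set_add_restrict)
  then have KS: "submodule (K j) R M" "K j \<subseteq> N" for j
    unfolding N.submodules.coindependent_sequence_def
    using N by (auto simp: submodule_restrict_iff)
  define F where "F n = N \<inter> (\<Inter>j\<in>{..<n} - {i}. K j)" for n
  have FN: "F n = N.submodules.meet ({..<n} - {i}) K" for n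
    unfolding F_def N.submodules.meet_def by simp
  have FS: "submodule (F n) R M" for n
    using N.submodule_meet[of "{..<n} - {i}" K] KS N by (simp add: FN submodule_restrict_iff)
  have Fdec: "antimono F" by (intro antimono_iff_le_Suc[THEN iffD2] allI) (auto simp: F_def)
  have "K i <+>\<^bsub>M\<^esub> F n = N" for n
  proof
    show "K i <+>\<^bsub>M\<^esub> F n \<subseteq> N" using KS FS N by (intro submodules.join_least) (auto simp: F_def)
    define m where "m = max n (Suc i)"
    have "N.submodules.coindependent {..<m} K"
      using K unfolding N.submodules.coindependent_sequence_def by blast
    then have "K i <+>\<^bsub>M\<lparr>carrier := N\<rparr>\<^esub> N.submodules.meet ({..<m} - {i}) K = carrier (M\<lparr>carrier := N\<rparr>)"
      unfolding N.submodules.coindependent_def by (simp add: m_def)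
    then have "N = K i <+>\<^bsub>M\<^esub> F m"
      unfolding FN set_add_restrict by simp
    also have "\<dots> \<subseteq> K i <+>\<^bsub>M\<^esub> F n"
      using KS FS antimonoD[OF Fdec, of n m] by (intro submodules.join_mono) (auto simp: m_def)
    finally show "N \<subseteq> K i <+>\<^bsub>M\<^esub> F n" .
  qed
  then have "K i <+>\<^bsub>M\<^esub> (\<Inter>n. F n) = N"
    using AB5_star_decreasing[of "K i" F, OF AB5 KS(1) FS Fdec] by simp
  moreover have "(\<Inter>n. F n) = N \<inter> (\<Inter>j\<in>-{i}. K j)"
    by (auto simp: F_def)
  ultimately show ?thesis by simp
qed

lemma finite_hollow_dim_subset_Rad:
  assumes AB5: "AB5_star R M"
    and small_fhd: "\<And>U. small_submodule R M U \<Longrightarrow> finite_hollow_dim R (M\<lparr>carrier := U\<rparr>)"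
    and N: "submodule N R M" "N \<subseteq> Rad R M"
  shows "finite_hollow_dim R (M\<lparr>carrier := N\<rparr>)"
proof -
  interpret N: left_module R "M\<lparr>carrier := N\<rparr>" using N(1) by (rule left_module_submodule)
  have False if "N.submodules.coindependent_sequence K" for K
  proof -
    have KS: "submodule (K j) R M" "K j \<subseteq> N" "K j \<noteq> N" for j
      using that N(1) unfolding N.submodules.coindependent_sequence_def
      by (auto simp: submodule_restrict_iff)
    have complete: "K i <+>\<^bsub>M\<^esub> (N \<inter> (\<Inter>j\<in>-{i}. K j)) = N" for i
      using coindependent_sequence_complete[OF AB5 N(1)] that by (simp add: set_add_restrict)
    define L where "L = (\<Inter>j. K j)"
    have L: "submodule L R M" "L \<subseteq> N" using KS unfolding L_def by (auto intro!: submodule_Inter) blast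
    obtain C where C: "submodule C R M" "C \<subseteq> N" "L <+>\<^bsub>M\<^esub> C = N"
      and minimal: "\<And>A. \<lbrakk>submodule A R M; A \<subseteq> C; L <+>\<^bsub>M\<^esub> A = N\<rbrakk> \<Longrightarrow> A = C"
      using minimal_supplement[OF AB5 N(1) L] by metis
    have D: "small_submodule R M (C \<inter> L)"
      by (rule minimal_supplement_small[OF L(1) C(1,3) minimal])
    \<comment> \<open>Otherwise the meet \<open>P\<close> of the other members, which is \<open>L + (C \<inter> P)\<close>, would lie in \<open>K i\<close>.\<close>
    have "\<exists>y. y \<in> C \<and> y \<notin> K i \<and> (\<forall>j. j \<noteq> i \<longrightarrow> y \<in> K j)" for i
    proof (rule ccontr)
      assume none: "\<not> ?thesis"
      define P where "P = N \<inter> (\<Inter>j\<in>-{i}. K j)"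
      have "P = \<Inter>(insert N (K ` (-{i})))" by (auto simp: P_def)
      then have P: "submodule P R M" using N KS submodule_Inter[of "insert N (K ` (-{i}))"] by auto
      have PC: "submodule (C \<inter> P) R M" by (rule submodule_Int[OF C(1) P])
      have LP: "L \<subseteq> P" using L by (auto simp: P_def L_def)
      have LK: "L \<subseteq> K i" by (auto simp: L_def)
      have "C \<inter> P \<subseteq> K i" using none by (auto simp: P_def)
      moreover have "P \<subseteq> (L <+>\<^bsub>M\<^esub> C) \<inter> P" unfolding C(3) by (auto simp: P_def)
      moreover have "(L <+>\<^bsub>M\<^esub> C) \<inter> P \<subseteq> L <+>\<^bsub>M\<^esub> (C \<inter> P)"
        using L C P LP by (intro submodules.modular) auto
      moreover have "L <+>\<^bsub>M\<^esub> (C \<inter> P) \<subseteq> K i" if "C \<inter> P \<subseteq> K i"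
        using L PC KS that LK by (intro submodules.join_least) auto
      ultimately have "P \<subseteq> K i" by blast
      then have "K i <+>\<^bsub>M\<^esub> P \<subseteq> K i" using KS P by (intro submodules.join_least) auto
      then show False using complete[of i] KS[of i] by (auto simp: P_def)
    qed
    then obtain y where y: "\<And>i. y i \<in> C" "\<And>i. y i \<notin> K i" "\<And>i j. j \<noteq> i \<Longrightarrow> y i \<in> K j"
      by metis
    have ycar: "y i \<in> carrier M" for i using y(1) submodule_subset[OF C(1)] by blast
    have "\<exists>T. small_submodule R M T \<and> y i \<in> T" for i
      using Rad_in_small_submodule y(1) C(2) N(2) by blast
    then obtain T where T: "\<And>i. small_submodule R M (T i)" "\<And>i. y i \<in> T i" by metis
    have TS: "submodule (T i) R M" for i using T by (simp add: small_submodule_def)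
    define U where "U n = generated (y ` {n..})" for n
    have US: "submodule (U n) R M" for n
      unfolding U_def using ycar by (intro submodule_generated) auto
    have yU: "n \<le> i \<Longrightarrow> y i \<in> U n" for n i
      unfolding U_def using generated_superset[of "y ` {n..}"] by auto
    have Uleast: "\<lbrakk>submodule A R M; \<And>i. n \<le> i \<Longrightarrow> y i \<in> A\<rbrakk> \<Longrightarrow> U n \<subseteq> A" for A n
      unfolding U_def by (rule generated_least) auto
    have Udec: "antimono U" by (intro antimono_iff_le_Suc[THEN iffD2] allI Uleast US yU) simp
    have step: "U n \<subseteq> T n <+>\<^bsub>M\<^esub> U (Suc n)" for n
    proof (rule Uleast[OF submodule_set_add[OF TS US]])
      fix i assume "n \<le> i"
      then show "y i \<in> T n <+>\<^bsub>M\<^esub> U (Suc n)"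
        using T(2)[of n] yU[of "Suc n" i] set_add_upper1[OF TS US, of n "Suc n"]
          set_add_upper2[OF TS US, of "Suc n" n]
        by (cases "i = n") auto
    qed
    have limit: "(\<Inter>n. U n) \<subseteq> C \<inter> L"
    proof -
      \<comment> \<open>The generators of \<open>U (Suc j)\<close> have an index other than \<open>j\<close>.\<close>
      have "U (Suc j) \<subseteq> K j" for j using KS y(3) by (intro Uleast) auto
      moreover have "U 0 \<subseteq> C" using C y by (intro Uleast) auto
      ultimately show ?thesis unfolding L_def by blast
    qed
    have small: "small_submodule R M (U 0)"
      by (rule small_submodule_by_tails[of U T "C \<inter> L"]) (fact AB5 US Udec T(1) step D limit)+
    interpret U: left_module R "M\<lparr>carrier := U 0\<rparr>" using US by (rule left_module_submodule)
    define B where "B i = U 0 \<inter> K i" for i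
    have BS: "submodule (B i) R M" for i unfolding B_def by (rule submodule_Int[OF US KS(1)])
    have "U.submodules.coindependent {..<n} B" for n
      unfolding U.submodules.coindependent_def
    proof
      fix i
      let ?E = "U.submodules.meet ({..<n} - {i}) B"
      have Bi: "submodule (B i) R (M\<lparr>carrier := U 0\<rparr>)"
        using BS by (simp add: submodule_restrict_iff[OF US] B_def)
      have E: "submodule ?E R (M\<lparr>carrier := U 0\<rparr>)"
        using BS by (intro U.submodule_meet) (auto simp: submodule_restrict_iff[OF US] B_def)
      have ES: "submodule ?E R M" using E by (simp add: submodule_restrict_iff[OF US])
      have "U 0 \<subseteq> B i <+>\<^bsub>M\<^esub> ?E"
      proof (rule Uleast[OF submodule_set_add[OF BS ES]])
        fix k
        show "y k \<in> B i <+>\<^bsub>M\<^esub> ?E"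
        proof (cases "k = i")
          case True
          then have "y k \<in> ?E"
            unfolding U.submodules.meet_def using y(3) yU by (auto simp: B_def)
          then show ?thesis using set_add_upper2[OF BS ES] by blast
        next
          case False
          then have "y k \<in> B i" using y(3) yU by (auto simp: B_def)
          then show ?thesis using set_add_upper1[OF BS ES] by blast
        qed
      qed
      then have "carrier (M\<lparr>carrier := U 0\<rparr>) \<subseteq> B i <+>\<^bsub>M\<lparr>carrier := U 0\<rparr>\<^esub> ?E"
        unfolding set_add_restrict by simp
      then show "B i <+>\<^bsub>M\<lparr>carrier := U 0\<rparr>\<^esub> ?E = carrier (M\<lparr>carrier := U 0\<rparr>)"
        using Bi E by (intro U.submodules.join_eq_topI CollectI)
    qed
    moreover have "B i \<noteq> U 0" for i using y(2)[of i] yU[of 0 i] by (auto simp: B_def)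
    ultimately have "U.submodules.coindependent_sequence B"
      unfolding U.submodules.coindependent_sequence_def
      using BS by (auto simp: submodule_restrict_iff[OF US] B_def)
    then show False using small_fhd[OF small] U.finite_hollow_dim_iff by blast
  qed
  then show ?thesis using N.finite_hollow_dim_iff by blast
qed

end

theorem theorem5:
  fixes R :: "('r, 'p) ring_scheme" and M :: "('r, 'm, 'q) module_scheme"
  assumes "left_module R M"
    and "AB5_star R M"
    and "\<And>N. small_submodule R M N \<Longrightarrow> finite_hollow_dim R (M\<lparr>carrier := N\<rparr>)"
  shows "\<forall>N. submodule N R M \<and> N \<subseteq> Rad R M \<longrightarrow> finite_hollow_dim R (M\<lparr>carrier := N\<rparr>)"
proof (intro allI impI)
  fix N assume "submodule N R M \<and> N \<subseteq> Rad R M"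
  then show "finite_hollow_dim R (M\<lparr>carrier := N\<rparr>)"
    using left_module.finite_hollow_dim_subset_Rad[of R M N] assms by simp
qed

end
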